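(* Let $d\equiv 3 \pmod 4$ and let $\mathbb{F}_q$ be a finite field with $q\equiv 3\pmod 4$. Assume that the following extension estimate holds for spheres in $\mathbb{F}_q^{d-1}$: there is a constant $C_0>0$, independent of $q$, such that for every $r\in\mathbb{F}_q\setminus\{0\}$ and every function $f\colon S_r\to\mathbb{C}$, \[\Big(\sum_{c\in\mathbb{F}_q^{d-1}}\big|(f\,d\sigma)^\vee(c)\big|^{\frac{2d+2}{d-1}}\Big)^{\frac{d-1}{2d+2}}\le C_0\Big(|S_r|^{-1}\sum_{x\in S_r}|f(x)|^2\Big)^{1/2}.\] Then there are constants $C,c>0$ (depending only on $d$ and $C_0$) such that for every set $E\subset P_d$ with $|E|\ge C\,q^{\frac{(d-1)^2+2(d-1)}{2(d-1)+2}}=C\,q^{\frac{d}{2}-\frac{1}{2d}}$ we have $|\prod(E)|\ge c\,q$.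
   Context: $\mathbb{F}_q$ is the finite field with $q$ elements and $\chi$ is a fixed nontrivial additive character of $\mathbb{F}_q$. For $x,y\in\mathbb{F}_q^n$, $x\cdot y=\sum_i x_iy_i$. For $E\subset\mathbb{F}_q^d$, $\prod(E):=\{x\cdot y\colon x,y\in E\}\subset\mathbb{F}_q$. The paraboloid is $P_d:=\{x\in\mathbb{F}_q^d\colon x_d=x_1^2+\cdots+x_{d-1}^2\}$. For $r\in\mathbb{F}_q$, the sphere in $\mathbb{F}_q^{d-1}$ is $S_r:=\{x\in\mathbb{F}_q^{d-1}\colon x_1^2+\cdots+x_{d-1}^2=r\}$. For $f\colon S_r\to\mathbb{C}$ and $c\in\mathbb{F}_q^{d-1}$, $(f\,d\sigma)^\vee(c):=|S_r|^{-1}\sum_{x\in S_r}\chi(c\cdot x)f(x)$. *)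

theory Defs
  imports Complex_Main "HOL-Library.FuncSet" "HOL-Algebra.Ring"
begin

text \<open>
  The constants in the theorem have to be uniform over all finite fields, so the field is an
  object that can be quantified over inside a formula: a record \<open>F\<close> of HOL-Algebra
  with \<open>field F\<close> and finite carrier, and \<open>q = card (carrier F)\<close>.
  The underlying type is arbitrary; over any infinite type, such as \<^typ>\<open>nat\<close>,
  the records \<open>F\<close> represent all finite fields up to isomorphism.

  Vectors of length \<open>n\<close> are functions on \<open>{1..n}\<close>, extended by
  \<^const>\<open>undefined\<close>, so that sets of vectors have the right cardinality.
\<close>

definition ff_vecs :: "('a, 'm) ring_scheme \<Rightarrow> nat \<Rightarrow> (nat \<Rightarrow> 'a) set" where
  "ff_vecs F n = {1..n} \<rightarrow>\<^sub>E carrier F"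

definition ff_dot :: "('a, 'm) ring_scheme \<Rightarrow> nat \<Rightarrow> (nat \<Rightarrow> 'a) \<Rightarrow> (nat \<Rightarrow> 'a) \<Rightarrow> 'a" where
  "ff_dot F n x y = (\<Oplus>\<^bsub>F\<^esub>i\<in>{1..n}. x i \<otimes>\<^bsub>F\<^esub> y i)"

definition ff_prod_set :: "('a, 'm) ring_scheme \<Rightarrow> nat \<Rightarrow> (nat \<Rightarrow> 'a) set \<Rightarrow> 'a set" where
  "ff_prod_set F n E = {ff_dot F n x y | x y. x \<in> E \<and> y \<in> E}"

definition ff_paraboloid :: "('a, 'm) ring_scheme \<Rightarrow> nat \<Rightarrow> (nat \<Rightarrow> 'a) set" where
  "ff_paraboloid F d =
     {x \<in> ff_vecs F d. x d = (\<Oplus>\<^bsub>F\<^esub>i\<in>{1..d - 1}. x i [^]\<^bsub>F\<^esub> (2::nat))}"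

definition ff_sphere :: "('a, 'm) ring_scheme \<Rightarrow> nat \<Rightarrow> 'a \<Rightarrow> (nat \<Rightarrow> 'a) set" where
  "ff_sphere F n r = {x \<in> ff_vecs F n. (\<Oplus>\<^bsub>F\<^esub>i\<in>{1..n}. x i [^]\<^bsub>F\<^esub> (2::nat)) = r}"

definition nontrivial_additive_character ::
    "('a, 'm) ring_scheme \<Rightarrow> ('a \<Rightarrow> complex) \<Rightarrow> bool" where
  "nontrivial_additive_character F \<chi> \<longleftrightarrow>
     (\<forall>x\<in>carrier F. norm (\<chi> x) = 1) \<and>
     (\<forall>x\<in>carrier F. \<forall>y\<in>carrier F. \<chi> (x \<oplus>\<^bsub>F\<^esub> y) = \<chi> x * \<chi> y) \<and>
     (\<exists>x\<in>carrier F. \<chi> x \<noteq> 1)"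

text \<open>\<open>(f d\<sigma>)\<^sup>\<or>(c)\<close> for the normalised surface measure on the sphere of radius \<open>r\<close> in
  dimension \<open>n\<close>; only the values of \<open>f\<close> on that sphere matter.\<close>

definition sphere_extension ::
    "('a, 'm) ring_scheme \<Rightarrow> ('a \<Rightarrow> complex) \<Rightarrow> nat \<Rightarrow> 'a \<Rightarrow> ((nat \<Rightarrow> 'a) \<Rightarrow> complex) \<Rightarrow>
      (nat \<Rightarrow> 'a) \<Rightarrow> complex" where
  "sphere_extension F \<chi> n r f c =
     inverse (of_nat (card (ff_sphere F n r))) *
       (\<Sum>x\<in>ff_sphere F n r. \<chi> (ff_dot F n c x) * f x)"

definition sphere_extension_estimate ::
    "('a, 'm) ring_scheme \<Rightarrow> ('a \<Rightarrow> complex) \<Rightarrow> nat \<Rightarrow> real \<Rightarrow> bool" where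
  "sphere_extension_estimate F \<chi> d C0 \<longleftrightarrow>
     (\<forall>r \<in> carrier F - {\<zero>\<^bsub>F\<^esub>}. \<forall>f.
        (\<Sum>c\<in>ff_vecs F (d - 1).
            norm (sphere_extension F \<chi> (d - 1) r f c) powr ((2 * real d + 2) / (real d - 1)))
          powr ((real d - 1) / (2 * real d + 2))
        \<le> C0 * sqrt (inverse (real (card (ff_sphere F (d - 1) r))) *
                  (\<Sum>x\<in>ff_sphere F (d - 1) r. (norm (f x))\<^sup>2)))"

lemma threshold_exponent:
  assumes "d > 0"
  shows "((real d - 1)^2 + 2 * (real d - 1)) / (2 * (real d - 1) + 2)
           = real d / 2 - 1 / (2 * real d)"
  using assms by (simp add: field_simps power2_eq_square)

end

theory Submission
  imports Defs "HOL-Analysis.Convex"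
begin

text \<open>
  Drop the last coordinate, which identifies \<open>E\<close> with a set \<open>A\<close> in dimension \<open>n = d - 1\<close> on which
  the products are \<open>x \<bullet> y + |x|\<^sup>2 |y|\<^sup>2\<close>. Completing the square, this is
  \<open>|y|\<^sup>2 |x - y'|\<^sup>2 - 1/4\<close> with the inversion \<open>y' = - y / (2 |y|\<^sup>2)\<close>, and it is \<open>- |x - y|\<^sup>2 / 2\<close>
  if \<open>x\<close> and \<open>y\<close> are isotropic. So it suffices to find a pin \<open>y\<close> in a set \<open>B\<close> from which
  \<open>A\<close> has many distances, which follows by Cauchy-Schwarz from an \<open>L\<^sup>2\<close> bound, summed over \<open>B\<close>,
  for the number \<open>\<nu> A y t\<close> of \<open>x \<in> A\<close> at distance \<open>t \<noteq> 0\<close> from \<open>y\<close>.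

  Plancherel in \<open>t\<close> and Gauss sums turn this \<open>L\<^sup>2\<close> norm into the sum over all radii \<open>r\<close> of
  \<open>|G A r y|\<^sup>2\<close>, where \<open>G A r\<close> is the extension to space of the Fourier transform of \<open>A\<close> restricted to
  the sphere of radius \<open>r\<close>. For \<open>r \<noteq> 0\<close> the extension estimate and Hoelder's inequality on \<open>B\<close> apply.
  For \<open>r = 0\<close> they do not, but as \<open>n / 2\<close> is odd and \<open>- 1\<close> is not a square, the Gauss sum to the power
  \<open>n\<close> is negative, and the term is absorbed by the omitted distance \<open>t = 0\<close>.
\<close>

section \<open>Plancherel and Hoelder inequalities for finite sums\<close>

text \<open>Expanding the square and summing over \<open>U\<close> first, orthogonality leaves the
  diagonal. The same argument serves Plancherel in the field variable, for \<open>hat\<close> and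
  for \<open>G\<close>.\<close>

lemma norm_sum_mult_sq:
  fixes e :: "'u \<Rightarrow> 'r \<Rightarrow> complex"
  assumes fin: "finite U" "finite R"
    and orth: "\<And>r r'. r \<in> R \<Longrightarrow> r' \<in> R \<Longrightarrow>
      (\<Sum>u\<in>U. e u r * cnj (e u r')) = (if r = r' then of_real K else 0)"
  shows "(\<Sum>u\<in>U. (norm (\<Sum>r\<in>R. e u r * G r))\<^sup>2) = K * (\<Sum>r\<in>R. (norm (G r))\<^sup>2)"
proof -
  have "complex_of_real (\<Sum>u\<in>U. (norm (\<Sum>r\<in>R. e u r * G r))\<^sup>2)
      = (\<Sum>u\<in>U. (\<Sum>r\<in>R. e u r * G r) * (\<Sum>r'\<in>R. cnj (e u r') * cnj (G r')))"
    unfolding of_real_sum by (intro sum.cong refl) (simp add: complex_norm_square del: of_real_power)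
  also have "\<dots> = (\<Sum>u\<in>U. \<Sum>r\<in>R. \<Sum>r'\<in>R. (G r * cnj (G r')) * (e u r * cnj (e u r')))"
    by (simp add: sum_product algebra_simps)
  also have "\<dots> = (\<Sum>r\<in>R. \<Sum>r'\<in>R. (G r * cnj (G r')) * (\<Sum>u\<in>U. e u r * cnj (e u r')))"
    unfolding sum_distrib_left
    by (subst sum.swap, intro sum.cong refl, subst sum.swap) simp
  also have "\<dots> = (\<Sum>r\<in>R. \<Sum>r'\<in>R. if r = r' then of_real K * (G r * cnj (G r)) else 0)"
    by (intro sum.cong refl) (simp add: orth)
  also have "\<dots> = (\<Sum>r\<in>R. of_real K * (G r * cnj (G r)))"
    using fin by (intro sum.cong refl) simp
  also have "\<dots> = complex_of_real (K * (\<Sum>r\<in>R. (norm (G r))\<^sup>2))"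
    unfolding sum_distrib_left of_real_sum
    by (intro sum.cong refl) (simp add: complex_norm_square del: of_real_power)
  finally show ?thesis by (simp only: of_real_eq_iff)
qed

lemma sum_le_card_powr_holder_pos:
  fixes a :: "'b \<Rightarrow> real"
  assumes "finite B" "s \<ge> 1" "\<And>y. y \<in> B \<Longrightarrow> a y > 0"
  shows "(\<Sum>y\<in>B. a y) \<le> real (card B) powr (1 - 1/s) * (\<Sum>y\<in>B. a y powr s) powr (1/s)"
proof (cases "B = {}")
  case False
  define N where "N = real (card B)"
  have N: "N > 0" using False assms(1) by (simp add: N_def card_gt_0_iff)
  have "(\<Sum>y\<in>B. (1/N) *\<^sub>R a y) powr s \<le> (\<Sum>y\<in>B. (1/N) * (a y powr s))"
    using N assms
    by (intro convex_on_sum[OF _ _ powr_convex[OF assms(2)]]) (auto simp: N_def)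
  then have "((\<Sum>y\<in>B. a y) / N) powr s \<le> (\<Sum>y\<in>B. a y powr s) / N"
    by (simp add: sum_divide_distrib)
  then have "(((\<Sum>y\<in>B. a y) / N) powr s) powr (1/s) \<le> ((\<Sum>y\<in>B. a y powr s) / N) powr (1/s)"
    using assms N by (intro powr_mono2) auto
  then have "(\<Sum>y\<in>B. a y) / N \<le> (\<Sum>y\<in>B. a y powr s) powr (1/s) / N powr (1/s)"
    using N assms by (simp add: powr_powr powr_divide sum_nonneg less_imp_le)
  then have "(\<Sum>y\<in>B. a y) \<le> N * ((\<Sum>y\<in>B. a y powr s) powr (1/s) / N powr (1/s))"
    using N by (simp add: field_simps)
  also have "\<dots> = N powr (1 - 1/s) * (\<Sum>y\<in>B. a y powr s) powr (1/s)"
    using N by (simp add: powr_diff)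
  finally show ?thesis by (simp add: N_def)
qed simp

text \<open>Zero values contribute to neither sum, so the positive case applies to the support; its
  cardinality may be enlarged to that of \<open>B\<close> because \<open>1 - 1/s\<close> is
  nonnegative.\<close>

lemma sum_le_card_powr_holder:
  fixes a :: "'b \<Rightarrow> real"
  assumes "finite B" "s \<ge> 1" and nonneg: "\<And>y. y \<in> B \<Longrightarrow> a y \<ge> 0"
  shows "(\<Sum>y\<in>B. a y) \<le> real (card B) powr (1 - 1/s) * (\<Sum>y\<in>B. a y powr s) powr (1/s)"
proof -
  define P where "P = {y \<in> B. a y > 0}"
  have P: "P \<subseteq> B" "finite P" using assms(1) by (auto simp: P_def)
  have zero: "a y = 0" if "y \<in> B - P" for y
    using that nonneg[of y] by (auto simp: P_def)
  have "(\<Sum>y\<in>B. a y) = (\<Sum>y\<in>P. a y)"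
    using P assms(1) zero by (intro sum.mono_neutral_right) auto
  also have "\<dots> \<le> real (card P) powr (1 - 1/s) * (\<Sum>y\<in>P. a y powr s) powr (1/s)"
    using P assms(2) by (intro sum_le_card_powr_holder_pos) (auto simp: P_def)
  also have "(\<Sum>y\<in>P. a y powr s) = (\<Sum>y\<in>B. a y powr s)"
    using P assms(1) zero by (intro sum.mono_neutral_left) auto
  also have "real (card P) powr (1 - 1/s) \<le> real (card B) powr (1 - 1/s)"
    using P assms(1,2) by (intro powr_mono2) (auto intro: card_mono)
  finally show ?thesis by (simp add: mult_right_mono)
qed

section \<open>Additive characters of a finite field with q = 3 mod 4\<close>

locale finite_field_character = field F for F :: "('a, 'm) ring_scheme" (structure) +
  fixes \<chi> :: "'a \<Rightarrow> complex"
  assumes finite_carrier: "finite (carrier F)"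
    and card_mod_4: "card (carrier F) mod 4 = 3"
    and character: "nontrivial_additive_character F \<chi>"
begin

abbreviation "q \<equiv> card (carrier F)"

lemma q_ge_3: "q \<ge> 3"
  using card_mod_4 by presburger

lemma norm_chi [simp]: "x \<in> carrier F \<Longrightarrow> norm (\<chi> x) = 1"
  and chi_add: "x \<in> carrier F \<Longrightarrow> y \<in> carrier F \<Longrightarrow> \<chi> (x \<oplus> y) = \<chi> x * \<chi> y"
  and chi_nontrivial: "\<exists>x\<in>carrier F. \<chi> x \<noteq> 1"
  using character unfolding nontrivial_additive_character_def by auto

lemma chi_nonzero [simp]: "x \<in> carrier F \<Longrightarrow> \<chi> x \<noteq> 0"
  using norm_chi by fastforce

lemma chi_zero [simp]: "\<chi> \<zero> = 1"
  using chi_add[of \<zero> \<zero>] by simp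

lemma chi_uminus: "x \<in> carrier F \<Longrightarrow> \<chi> (\<ominus> x) = cnj (\<chi> x)"
proof -
  assume x: "x \<in> carrier F"
  have "\<chi> x * \<chi> (\<ominus> x) = \<chi> x * cnj (\<chi> x)"
    using x chi_add[of x "\<ominus> x"]
    by (simp add: r_neg complex_norm_square[symmetric])
  then show ?thesis using x by simp
qed

lemma chi_finsum:
  assumes "finite S" "f \<in> S \<rightarrow> carrier F"
  shows "\<chi> (finsum F f S) = (\<Prod>i\<in>S. \<chi> (f i))"
  using assms by (induction S) (auto simp: chi_add finsum_insert)

lemma pow2: "x \<in> carrier F \<Longrightarrow> x [^] (2::nat) = x \<otimes> x"
  by (simp add: numeral_2_eq_2)

lemma bij_translate: "b \<in> carrier F \<Longrightarrow> bij_betw (\<lambda>a. a \<oplus> b) (carrier F) (carrier F)"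
  by (rule bij_betwI[where g = "\<lambda>a. a \<ominus> b"]) (auto simp: minus_eq a_assoc r_neg l_neg)

lemma inv_closed_nz [simp]: "u \<in> carrier F \<Longrightarrow> u \<noteq> \<zero> \<Longrightarrow> inv u \<in> carrier F"
  and inv_nz [simp]: "u \<in> carrier F \<Longrightarrow> u \<noteq> \<zero> \<Longrightarrow> inv u \<noteq> \<zero>"
  and r_inv_nz [simp]: "u \<in> carrier F \<Longrightarrow> u \<noteq> \<zero> \<Longrightarrow> u \<otimes> inv u = \<one>"
  and l_inv_nz [simp]: "u \<in> carrier F \<Longrightarrow> u \<noteq> \<zero> \<Longrightarrow> inv u \<otimes> u = \<one>"
  using field_Units Units_inv_closed[of u] Units_inv_Units[of u] Units_r_inv[of u] Units_l_inv[of u] by auto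

lemma inv_inv_nz [simp]: "u \<in> carrier F \<Longrightarrow> u \<noteq> \<zero> \<Longrightarrow> inv (inv u) = u"
  using field_Units Units_inv_inv[of u] by auto

lemma bij_scale:
  assumes "b \<in> carrier F" "b \<noteq> \<zero>"
  shows "bij_betw (\<lambda>a. b \<otimes> a) (carrier F) (carrier F)"
  using assms
  by (intro bij_betwI[where g = "\<lambda>a. inv b \<otimes> a"]) (auto simp: m_assoc[symmetric])

text \<open>For nonzero \<open>b\<close> a dilation removes \<open>b\<close>. A translation by some
  \<open>c\<close> with \<open>\<chi> c \<noteq> 1\<close> then multiplies the sum by
  \<open>\<chi> c\<close>, so it vanishes.\<close>

lemma sum_chi_mult:
  assumes b: "b \<in> carrier F"
  shows "(\<Sum>a\<in>carrier F. \<chi> (a \<otimes> b)) = (if b = \<zero> then of_nat q else 0)"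
proof (cases "b = \<zero>")
  case False
  obtain c where c: "c \<in> carrier F" "\<chi> c \<noteq> 1" using chi_nontrivial by blast
  have "(\<Sum>a\<in>carrier F. \<chi> (a \<otimes> b)) = (\<Sum>a\<in>carrier F. \<chi> (b \<otimes> a))"
    using b by (intro sum.cong refl) (simp add: m_comm)
  also have "\<dots> = (\<Sum>a\<in>carrier F. \<chi> a)"
    by (rule sum.reindex_bij_betw[OF bij_scale[OF b False]])
  finally have 1: "(\<Sum>a\<in>carrier F. \<chi> (a \<otimes> b)) = (\<Sum>a\<in>carrier F. \<chi> a)" .
  have "(\<Sum>a\<in>carrier F. \<chi> a) = (\<Sum>a\<in>carrier F. \<chi> (a \<oplus> c))"
    by (rule sum.reindex_bij_betw[OF bij_translate[OF c(1)], symmetric])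
  also have "\<dots> = (\<Sum>a\<in>carrier F. \<chi> a) * \<chi> c"
    unfolding sum_distrib_right using c by (intro sum.cong refl) (simp add: chi_add)
  finally have "(\<Sum>a\<in>carrier F. \<chi> a) = 0" using c by simp
  then show ?thesis using 1 False by simp
qed simp

definition two :: 'a where "two = \<one> \<oplus> \<one>"
definition quarter :: 'a where "quarter = inv two \<otimes> inv two"

lemma two_closed [simp]: "two \<in> carrier F"
  by (simp add: two_def)

text \<open>The order of the additive group annihilates \<open>\<one>\<close>. As \<open>q\<close>
  is odd, the \<open>q\<close>-fold multiple of \<open>\<one>\<close> would be \<open>\<one>\<close>
  itself if \<open>two\<close> were zero.\<close>

lemma two_nz [simp]: "two \<noteq> \<zero>"
proof
  assume t: "two = \<zero>"
  have e: "add_pow F (2 * k) \<one> = \<zero>" for k :: nat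
    using t by (induction k) (auto simp: two_def a_assoc)
  have "add_pow F q \<one> = \<zero>"
    using add.power_order_eq_one[OF finite_carrier, of \<one>] by simp
  moreover have "q = Suc (2 * (q div 2))" using card_mod_4 by presburger
  ultimately have "\<one> = \<zero>"
    using e[of "q div 2"] by (metis add.nat_pow_Suc l_zero one_closed)
  then show False by simp
qed

lemma quarter_closed [simp]: "quarter \<in> carrier F"
  by (simp add: quarter_def)

lemma quarter_nz [simp]: "quarter \<noteq> \<zero>"
  by (simp add: quarter_def integral_iff)

lemma uminus_nz: "a \<in> carrier F \<Longrightarrow> a \<noteq> \<zero> \<Longrightarrow> \<ominus> a \<noteq> \<zero>"
  by (metis minus_minus minus_zero)

lemma minus_eq_zero_iff: "a \<in> carrier F \<Longrightarrow> b \<in> carrier F \<Longrightarrow> a \<ominus> b = \<zero> \<longleftrightarrow> a = b"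
  using sum_zero_eq_neg[of a "\<ominus> b"] by (auto simp: minus_eq minus_minus r_neg)

lemma two_mult: "a \<in> carrier F \<Longrightarrow> two \<otimes> a = a \<oplus> a"
  by (simp add: two_def l_distr)

text \<open>Fermat's little theorem: the exponent \<open>q - 1\<close> is twice an odd number.\<close>

lemma minus_one_not_square:
  assumes a: "a \<in> carrier F"
  shows "a \<otimes> a \<noteq> \<ominus> \<one>"
proof
  assume s: "a \<otimes> a = \<ominus> \<one>"
  have nz: "a \<noteq> \<zero>"
    using s uminus_nz[of \<one>] by fastforce
  then have u: "a \<in> Units F" using a field_Units by auto
  have cU: "card (Units F) = q - 1"
    using finite_carrier field_Units by simp
  have p: "a [^] (4 * k :: nat) = \<one>" for k
  proof (induction k)
    case (Suc k)
    have "a [^] (4::nat) = (a \<otimes> a) \<otimes> (a \<otimes> a)"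
      using a by (simp add: eval_nat_numeral m_assoc)
    also have "\<dots> = \<one>" unfolding s by algebra
    finally have "a [^] (4 :: nat) = \<one>" .
    then show ?case using Suc a by (simp add: nat_pow_mult[symmetric])
  qed simp
  have e: "q - 1 = 4 * ((q - 1) div 4) + 2" using card_mod_4 by presburger
  have "\<one> = a [^] (q - 1)"
    using units_power_order_eq_one[OF _ u] finite_carrier field_Units cU by auto
  also have "\<dots> = a \<otimes> a" using a p[of "(q-1) div 4"]
    by (subst e) (simp add: nat_pow_mult[symmetric] pow2)
  finally have "\<one> = \<ominus> \<one>" using s by simp
  then have "\<one> \<oplus> \<one> = \<zero>" by (metis one_closed r_neg)
  then show False using two_nz by (simp add: two_def)
qed

section \<open>Quadratic Gauss sums\<close>

definition gauss :: "'a \<Rightarrow> complex" where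
  "gauss u = (\<Sum>a\<in>carrier F. \<chi> (u \<otimes> (a \<otimes> a)))"

text \<open>Since \<open>- 1\<close> is not a square, signs can be attached to the squares so that every element
  of the field occurs exactly once.\<close>

lemma signed_square_bij:
  obtains T where "bij_betw (\<lambda>a. if a \<in> T then a \<otimes> a else \<ominus> (a \<otimes> a)) (carrier F) (carrier F)"
proof -
  obtain f :: "'a \<Rightarrow> nat" where f: "inj_on f (carrier F)"
    using finite_imp_inj_to_nat_seg[OF finite_carrier] by blast
  \<comment> \<open>The injection into the naturals serves as a tie-breaker: for nonzero
    \<open>a\<close>, exactly one of \<open>a\<close> and \<open>\<ominus> a\<close> lies in
    \<open>T\<close>.\<close>
  define T where "T = {a \<in> carrier F. f a < f (\<ominus> a)}"
  define \<psi> where "\<psi> = (\<lambda>a. if a \<in> T then a \<otimes> a else \<ominus> (a \<otimes> a))"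
  have T: "a \<in> T \<longleftrightarrow> \<ominus> a \<notin> T" if "a \<in> carrier F" "a \<noteq> \<zero>" for a
  proof -
    have "a \<noteq> \<ominus> a"
    proof
      assume "a = \<ominus> a"
      then have "two \<otimes> a = \<zero>" using that by (metis two_mult r_neg)
      then show False using that by (simp add: integral_iff)
    qed
    then have "f a \<noteq> f (\<ominus> a)" using f that by (auto simp: inj_on_def)
    then show ?thesis using that by (auto simp: T_def minus_minus)
  qed
  have root: "b = a \<or> b = \<ominus> a" if "a \<in> carrier F" "b \<in> carrier F" "a \<otimes> a = b \<otimes> b" for a b
  proof -
    have "(b \<ominus> a) \<otimes> (b \<oplus> a) = b \<otimes> b \<ominus> a \<otimes> a" using that(1,2) by algebra
    also have "\<dots> = \<zero>" using that by (simp add: minus_eq r_neg)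
    finally have "b \<ominus> a = \<zero> \<or> b \<oplus> a = \<zero>" using that by (simp add: integral_iff)
    then show ?thesis
      using that sum_zero_eq_neg[of b a] sum_zero_eq_neg[of b "\<ominus> a"] by (auto simp: minus_eq minus_minus)
  qed
  \<comment> \<open>If \<open>b\<close> is nonzero, dividing by it would exhibit
    \<open>\<ominus> \<one>\<close> as a square.\<close>
  have nonroot: "a = \<zero> \<and> b = \<zero>" if "a \<in> carrier F" "b \<in> carrier F" "a \<otimes> a = \<ominus> (b \<otimes> b)" for a b
  proof (cases "b = \<zero>")
    case True
    then show ?thesis using that by (simp add: integral_iff)
  next
    case False
    have "(a \<otimes> inv b) \<otimes> (a \<otimes> inv b) = (a \<otimes> a) \<otimes> (inv b \<otimes> inv b)"
      using that(1,2) inv_closed_nz[OF that(2) False] by algebra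
    also have "\<dots> = \<ominus> ((b \<otimes> inv b) \<otimes> (b \<otimes> inv b))"
      unfolding that(3) using that(2) inv_closed_nz[OF that(2) False] by algebra
    also have "\<dots> = \<ominus> \<one>" using that False by simp
    finally show ?thesis using minus_one_not_square[of "a \<otimes> inv b"] that False by simp
  qed
  have "inj_on \<psi> (carrier F)"
  proof (rule inj_onI)
    fix a b assume ab: "a \<in> carrier F" "b \<in> carrier F" "\<psi> a = \<psi> b"
    show "a = b"
    proof (cases "a \<in> T \<longleftrightarrow> b \<in> T")
      case True
      then have "a \<otimes> a = b \<otimes> b"
        using ab by (auto simp: \<psi>_def split: if_splits dest!: inj_onD[OF a_inv_inj])
      then show ?thesis using root[OF ab(1,2)] T[OF ab(1)] True by fastforce
    next
      case False
      then have "a \<otimes> a = \<ominus> (b \<otimes> b)"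
        using ab by (auto simp: \<psi>_def split: if_splits) (metis m_closed minus_minus)
      then show ?thesis using nonroot[OF ab(1,2)] by simp
    qed
  qed
  moreover have "\<psi> ` carrier F \<subseteq> carrier F" by (auto simp: \<psi>_def)
  ultimately have "bij_betw \<psi> (carrier F) (carrier F)"
    unfolding bij_betw_def using endo_inj_surj finite_carrier by blast
  then show ?thesis using that unfolding \<psi>_def by blast
qed

text \<open>The sign attached to \<open>a \<otimes> a\<close> only exchanges the two terms belonging
  to \<open>u\<close> and \<open>\<ominus> u\<close>. With signed squares each of the two sums runs
  over the whole field and vanishes by orthogonality.\<close>

lemma gauss_plus_gauss_uminus:
  assumes u: "u \<in> carrier F" "u \<noteq> \<zero>"
  shows "gauss u + gauss (\<ominus> u) = 0"
proof -
  obtain T where T: "bij_betw (\<lambda>a. if a \<in> T then a \<otimes> a else \<ominus> (a \<otimes> a)) (carrier F) (carrier F)"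
    (is "bij_betw ?\<psi> _ _") by (rule signed_square_bij)
  have z: "(\<Sum>a\<in>carrier F. \<chi> (?\<psi> a \<otimes> w)) = 0" if "w \<in> carrier F" "w \<noteq> \<zero>" for w
    using sum.reindex_bij_betw[OF T, of "\<lambda>a. \<chi> (a \<otimes> w)"] sum_chi_mult[of w] that by simp
  have "gauss u + gauss (\<ominus> u) = (\<Sum>a\<in>carrier F. \<chi> (?\<psi> a \<otimes> u) + \<chi> (?\<psi> a \<otimes> \<ominus> u))"
    unfolding gauss_def sum.distrib[symmetric] using u
    by (intro sum.cong refl) (simp add: l_minus r_minus minus_minus m_comm)
  also have "\<dots> = 0"
    unfolding sum.distrib using z[of u] z[of "\<ominus> u"] u uminus_nz[of u] by simp
  finally show ?thesis .
qed

text \<open>Substituting \<open>a = c \<oplus> b\<close> cancels the square of \<open>b\<close>.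
  What remains is linear in \<open>b\<close>, and the sum over \<open>b\<close> selects
  \<open>c = \<zero>\<close>.\<close>

lemma gauss_mult_gauss_uminus:
  assumes u: "u \<in> carrier F" "u \<noteq> \<zero>"
  shows "gauss u * gauss (\<ominus> u) = of_nat q"
proof -
  have "gauss u * gauss (\<ominus> u) =
      (\<Sum>b\<in>carrier F. (\<Sum>a\<in>carrier F. \<chi> (u \<otimes> (a \<otimes> a))) * \<chi> (\<ominus> u \<otimes> (b \<otimes> b)))"
    unfolding gauss_def by (simp add: sum_distrib_left)
  also have "\<dots> = (\<Sum>b\<in>carrier F. \<Sum>c\<in>carrier F. \<chi> (u \<otimes> (c \<otimes> c)) * \<chi> (b \<otimes> (two \<otimes> u \<otimes> c)))"
  proof (intro sum.cong refl)
    fix b assume b: "b \<in> carrier F"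
    have "(\<Sum>a\<in>carrier F. \<chi> (u \<otimes> (a \<otimes> a))) = (\<Sum>c\<in>carrier F. \<chi> (u \<otimes> ((c \<oplus> b) \<otimes> (c \<oplus> b))))"
      by (rule sum.reindex_bij_betw[OF bij_translate[OF b], symmetric])
    also have "\<dots> * \<chi> (\<ominus> u \<otimes> (b \<otimes> b)) =
        (\<Sum>c\<in>carrier F. \<chi> (u \<otimes> (c \<otimes> c)) * \<chi> (b \<otimes> (two \<otimes> u \<otimes> c)))"
      unfolding sum_distrib_right
    proof (intro sum.cong refl)
      fix c assume c: "c \<in> carrier F"
      have "u \<otimes> ((c \<oplus> b) \<otimes> (c \<oplus> b)) \<oplus> \<ominus> u \<otimes> (b \<otimes> b) = u \<otimes> (c \<otimes> c) \<oplus> b \<otimes> (two \<otimes> u \<otimes> c)"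
        using b c u(1) unfolding two_def by algebra
      then show "\<chi> (u \<otimes> ((c \<oplus> b) \<otimes> (c \<oplus> b))) * \<chi> (\<ominus> u \<otimes> (b \<otimes> b)) =
          \<chi> (u \<otimes> (c \<otimes> c)) * \<chi> (b \<otimes> (two \<otimes> u \<otimes> c))"
        using b c u(1) by (simp add: chi_add[symmetric])
    qed
    finally show "(\<Sum>a\<in>carrier F. \<chi> (u \<otimes> (a \<otimes> a))) * \<chi> (\<ominus> u \<otimes> (b \<otimes> b)) =
        (\<Sum>c\<in>carrier F. \<chi> (u \<otimes> (c \<otimes> c)) * \<chi> (b \<otimes> (two \<otimes> u \<otimes> c)))" .
  qed
  also have "\<dots> = (\<Sum>c\<in>carrier F. \<chi> (u \<otimes> (c \<otimes> c)) * (\<Sum>b\<in>carrier F. \<chi> (b \<otimes> (two \<otimes> u \<otimes> c))))"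
    by (subst sum.swap) (simp add: sum_distrib_left)
  also have "\<dots> = (\<Sum>c\<in>carrier F. if c = \<zero> then of_nat q else 0)"
    using u by (intro sum.cong refl) (auto simp: sum_chi_mult integral_iff)
  also have "\<dots> = of_nat q" using finite_carrier by simp
  finally show ?thesis .
qed

text \<open>The two preceding identities give \<open>gauss (\<ominus> u) = - gauss u\<close> and
  hence the minus sign, which is special to q = 3 mod 4.\<close>

lemma gauss_sq: "u \<in> carrier F \<Longrightarrow> u \<noteq> \<zero> \<Longrightarrow> (gauss u)\<^sup>2 = - of_nat q"
  using gauss_plus_gauss_uminus[of u] gauss_mult_gauss_uminus[of u]
  by (simp add: power2_eq_square add_eq_0_iff equation_minus_iff)

text \<open>Completing the square: the shift by \<open>w = b/(2u)\<close> absorbs the linear term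
  and leaves the constant \<open>- u w^2 = - b^2/(4u)\<close>.\<close>

lemma sum_chi_quadratic:
  assumes u: "u \<in> carrier F" "u \<noteq> \<zero>" and b: "b \<in> carrier F"
  shows "(\<Sum>a\<in>carrier F. \<chi> (u \<otimes> (a \<otimes> a) \<oplus> a \<otimes> b)) =
    gauss u * \<chi> (\<ominus> (quarter \<otimes> inv u) \<otimes> (b \<otimes> b))"
proof -
  define h where "h = inv two"
  have h: "h \<in> carrier F" "h \<oplus> h = \<one>" "quarter = h \<otimes> h"
    using two_mult[of "inv two"] by (auto simp: h_def quarter_def)
  define i where "i = inv u"
  have i: "i \<in> carrier F" "u \<otimes> i = \<one>" using u by (auto simp: i_def)
  define w where "w = h \<otimes> (i \<otimes> b)"
  have w: "w \<in> carrier F" using h i b by (simp add: w_def)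
  have 1: "u \<otimes> w = h \<otimes> b"
  proof -
    have "u \<otimes> w = (u \<otimes> i) \<otimes> (h \<otimes> b)" unfolding w_def using h(1) i(1) b u(1) by algebra
    then show ?thesis using i h b by simp
  qed
  have 2: "u \<otimes> (w \<otimes> w) = (quarter \<otimes> inv u) \<otimes> (b \<otimes> b)"
  proof -
    have "u \<otimes> (w \<otimes> w) = (u \<otimes> w) \<otimes> w" using u w by (simp add: m_assoc)
    also have "\<dots> = (h \<otimes> b) \<otimes> (h \<otimes> (i \<otimes> b))" unfolding 1 by (simp add: w_def)
    also have "\<dots> = (h \<otimes> h \<otimes> i) \<otimes> (b \<otimes> b)" using h(1) i(1) b by algebra
    finally show ?thesis using h i_def by simp
  qed
  have "u \<otimes> (a \<otimes> a) \<oplus> a \<otimes> b =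
      u \<otimes> ((a \<oplus> w) \<otimes> (a \<oplus> w)) \<oplus> \<ominus> (quarter \<otimes> inv u) \<otimes> (b \<otimes> b)" if a: "a \<in> carrier F" for a
  proof -
    have "u \<otimes> ((a \<oplus> w) \<otimes> (a \<oplus> w)) =
        u \<otimes> (a \<otimes> a) \<oplus> a \<otimes> (u \<otimes> w) \<oplus> a \<otimes> (u \<otimes> w) \<oplus> u \<otimes> (w \<otimes> w)"
      using u(1) a w by algebra
    also have "\<dots> = u \<otimes> (a \<otimes> a) \<oplus> (h \<oplus> h) \<otimes> (a \<otimes> b) \<oplus> u \<otimes> (w \<otimes> w)"
      unfolding 1 using u(1) a w b h(1) by algebra
    finally have 3: "u \<otimes> ((a \<oplus> w) \<otimes> (a \<oplus> w)) = u \<otimes> (a \<otimes> a) \<oplus> a \<otimes> b \<oplus> (quarter \<otimes> inv u) \<otimes> (b \<otimes> b)"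
      unfolding 2 h(2) using a b by simp
    have "X = X \<oplus> Y \<otimes> Z \<oplus> \<ominus> Y \<otimes> Z" if "X \<in> carrier F" "Y \<in> carrier F" "Z \<in> carrier F" for X Y Z
      using that by algebra
    then show ?thesis unfolding 3 using u a b by simp
  qed
  then have "(\<Sum>a\<in>carrier F. \<chi> (u \<otimes> (a \<otimes> a) \<oplus> a \<otimes> b)) =
     (\<Sum>a\<in>carrier F. \<chi> (u \<otimes> ((a \<oplus> w) \<otimes> (a \<oplus> w)))) * \<chi> (\<ominus> (quarter \<otimes> inv u) \<otimes> (b \<otimes> b))"
    unfolding sum_distrib_right using u w b
    by (intro sum.cong refl) (simp add: chi_add)
  also have "(\<Sum>a\<in>carrier F. \<chi> (u \<otimes> ((a \<oplus> w) \<otimes> (a \<oplus> w)))) = gauss u"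
    unfolding gauss_def by (rule sum.reindex_bij_betw[OF bij_translate[OF w]])
  finally show ?thesis .
qed

end

section \<open>Character sums over the space of dimension \<open>n = d - 1\<close>, twice an odd
  number\<close>

locale finite_field_space = finite_field_character F \<chi>
  for F :: "('a, 'm) ring_scheme" (structure) and \<chi> +
  fixes n k :: nat
  assumes n_eq: "n = 2 * k" and odd_k: "odd k"
begin

abbreviation "V \<equiv> ff_vecs F n"
abbreviation "dot \<equiv> ff_dot F n"

definition nrm :: "(nat \<Rightarrow> 'a) \<Rightarrow> 'a" where
  "nrm m = (\<Oplus>i\<in>{1..n}. m i [^] (2::nat))"

definition nd :: "(nat \<Rightarrow> 'a) \<Rightarrow> (nat \<Rightarrow> 'a) \<Rightarrow> 'a" where
  "nd x y = (\<Oplus>i\<in>{1..n}. (y i \<ominus> x i) \<otimes> (y i \<ominus> x i))"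

lemma vecs_closed [simp]: "x \<in> V \<Longrightarrow> i \<in> {1..n} \<Longrightarrow> x i \<in> carrier F"
  by (auto simp: ff_vecs_def)

lemma nrm_closed [simp]: "x \<in> V \<Longrightarrow> nrm x \<in> carrier F"
  and nd_closed [simp]: "x \<in> V \<Longrightarrow> y \<in> V \<Longrightarrow> nd x y \<in> carrier F"
  and dot_closed [simp]: "x \<in> V \<Longrightarrow> y \<in> V \<Longrightarrow> dot x y \<in> carrier F"
  unfolding nrm_def nd_def ff_dot_def by (auto intro!: finsum_closed)

lemma finite_V [simp]: "finite V"
  unfolding ff_vecs_def using finite_carrier by (intro finite_PiE) auto

lemma card_V: "card V = q ^ n"
  unfolding ff_vecs_def by (simp add: card_PiE)

lemma sphere_eq: "ff_sphere F n r = {x \<in> V. nrm x = r}"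
  by (simp add: ff_sphere_def nrm_def)

lemma finite_sphere [simp]: "finite (ff_sphere F n r)"
  by (simp add: sphere_eq)

lemma chi_mult_finsum:
  assumes "u \<in> carrier F" "f \<in> {1..n} \<rightarrow> carrier F"
  shows "\<chi> (u \<otimes> finsum F f {1..n}) = (\<Prod>i\<in>{1..n}. \<chi> (u \<otimes> f i))"
  using assms by (subst finsum_rdistr) (auto intro!: chi_finsum)

lemma chi_dot_cnj:
  assumes "m \<in> V" "x \<in> V" "y \<in> V"
  shows "\<chi> (dot m y) * cnj (\<chi> (dot m x)) = (\<Prod>i\<in>{1..n}. \<chi> (m i \<otimes> (y i \<ominus> x i)))"
proof -
  have "\<chi> (dot m y) * cnj (\<chi> (dot m x)) = (\<Prod>i\<in>{1..n}. \<chi> (m i \<otimes> y i)) * cnj (\<Prod>i\<in>{1..n}. \<chi> (m i \<otimes> x i))"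
    unfolding ff_dot_def using assms by (subst (1 2) chi_finsum) auto
  also have "\<dots> = (\<Prod>i\<in>{1..n}. \<chi> (m i \<otimes> y i) * \<chi> (\<ominus> (m i \<otimes> x i)))"
    unfolding prod.distrib cnj_prod using assms by (simp add: chi_uminus)
  also have "\<dots> = (\<Prod>i\<in>{1..n}. \<chi> (m i \<otimes> (y i \<ominus> x i)))"
    using assms
    by (intro prod.cong refl) (simp add: chi_add[symmetric] minus_eq r_distr r_minus)
  finally show ?thesis .
qed

text \<open>The sum over vectors factors into one sum per coordinate, and a single coordinate where
  \<open>x\<close> and \<open>y\<close> differ makes the product vanish.\<close>

lemma sum_chi_dot:
  assumes "x \<in> V" "y \<in> V"
  shows "(\<Sum>m\<in>V. \<chi> (dot m y) * cnj (\<chi> (dot m x))) = (if y = x then of_nat (q ^ n) else 0)"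
proof -
  have "(\<Sum>m\<in>V. \<chi> (dot m y) * cnj (\<chi> (dot m x))) = (\<Sum>m\<in>V. \<Prod>i\<in>{1..n}. \<chi> (m i \<otimes> (y i \<ominus> x i)))"
    using assms by (intro sum.cong refl chi_dot_cnj)
  also have "\<dots> = (\<Prod>i\<in>{1..n}. \<Sum>a\<in>carrier F. \<chi> (a \<otimes> (y i \<ominus> x i)))"
    unfolding ff_vecs_def using finite_carrier
    by (subst prod_sum_PiE[where f = "\<lambda>i a. \<chi> (a \<otimes> (y i \<ominus> x i))"]) auto
  also have "\<dots> = (\<Prod>i\<in>{1..n}. if y i \<ominus> x i = \<zero> then of_nat q else 0)"
    using assms by (intro prod.cong refl sum_chi_mult) auto
  also have "\<dots> = (\<Prod>i\<in>{1..n}. if y i = x i then of_nat q else 0)"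
    using assms by (intro prod.cong refl if_cong) (auto simp: minus_eq_zero_iff)
  also have "\<dots> = (if y = x then of_nat (q ^ n) else 0)"
  proof (cases "y = x")
    case False
    then obtain i where "i \<in> {1..n}" "y i \<noteq> x i"
      using assms unfolding ff_vecs_def by (metis PiE_ext)
    then show ?thesis using False by (auto intro!: prod_zero)
  qed simp
  finally show ?thesis .
qed

text \<open>This is the \<open>k\<close>-th power of \<open>- q\<close>, negative because
  \<open>k\<close> is odd. The sign is what makes the radius zero harmless later on.\<close>

lemma gauss_power:
  assumes "u \<in> carrier F" "u \<noteq> \<zero>"
  shows "gauss u ^ n = - of_nat (q ^ k)"
  using gauss_sq[OF assms] odd_k by (simp add: n_eq power_mult)

text \<open>The Fourier transform of a Gaussian: the sum factors over coordinates, and completing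
  the square in each produces a Gaussian in \<open>y - x\<close> with the dual parameter
  \<open>-1/(4u)\<close>.\<close>

lemma sum_chi_nrm:
  assumes u: "u \<in> carrier F" "u \<noteq> \<zero>" and xy: "x \<in> V" "y \<in> V"
  shows "(\<Sum>m\<in>V. \<chi> (u \<otimes> nrm m) * \<chi> (dot m y) * cnj (\<chi> (dot m x)))
    = - of_nat (q ^ k) * \<chi> (\<ominus> (quarter \<otimes> inv u) \<otimes> nd x y)"
proof -
  have "(\<Sum>m\<in>V. \<chi> (u \<otimes> nrm m) * \<chi> (dot m y) * cnj (\<chi> (dot m x))) =
    (\<Sum>m\<in>V. \<Prod>i\<in>{1..n}. \<chi> (u \<otimes> (m i \<otimes> m i) \<oplus> m i \<otimes> (y i \<ominus> x i)))"
  proof (intro sum.cong refl)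
    fix m assume m: "m \<in> V"
    have "\<chi> (u \<otimes> nrm m) = (\<Prod>i\<in>{1..n}. \<chi> (u \<otimes> (m i [^] (2::nat))))"
      unfolding nrm_def using m u by (intro chi_mult_finsum) auto
    then have "\<chi> (u \<otimes> nrm m) * (\<chi> (dot m y) * cnj (\<chi> (dot m x))) =
       (\<Prod>i\<in>{1..n}. \<chi> (u \<otimes> (m i [^] (2::nat)))) * (\<Prod>i\<in>{1..n}. \<chi> (m i \<otimes> (y i \<ominus> x i)))"
      by (simp add: chi_dot_cnj[OF m xy])
    also have "\<dots> = (\<Prod>i\<in>{1..n}. \<chi> (u \<otimes> (m i \<otimes> m i) \<oplus> m i \<otimes> (y i \<ominus> x i)))"
      unfolding prod.distrib[symmetric] using m u xy
      by (intro prod.cong refl) (simp add: chi_add pow2)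
    finally show "\<chi> (u \<otimes> nrm m) * \<chi> (dot m y) * cnj (\<chi> (dot m x)) = \<dots>"
      by (simp add: mult.assoc)
  qed
  also have "\<dots> = (\<Prod>i\<in>{1..n}. \<Sum>a\<in>carrier F. \<chi> (u \<otimes> (a \<otimes> a) \<oplus> a \<otimes> (y i \<ominus> x i)))"
    unfolding ff_vecs_def using finite_carrier
    by (subst prod_sum_PiE[where f = "\<lambda>i a. \<chi> (u \<otimes> (a \<otimes> a) \<oplus> a \<otimes> (y i \<ominus> x i))"]) auto
  also have "\<dots> = (\<Prod>i\<in>{1..n}. gauss u *
      \<chi> (\<ominus> (quarter \<otimes> inv u) \<otimes> ((y i \<ominus> x i) \<otimes> (y i \<ominus> x i))))"
    using u xy by (intro prod.cong refl sum_chi_quadratic) auto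
  also have "\<dots> = gauss u ^ n * (\<Prod>i\<in>{1..n}.
      \<chi> (\<ominus> (quarter \<otimes> inv u) \<otimes> ((y i \<ominus> x i) \<otimes> (y i \<ominus> x i))))"
    by (simp add: prod.distrib)
  also have "(\<Prod>i\<in>{1..n}. \<chi> (\<ominus> (quarter \<otimes> inv u) \<otimes> ((y i \<ominus> x i) \<otimes> (y i \<ominus> x i)))) =
      \<chi> (\<ominus> (quarter \<otimes> inv u) \<otimes> nd x y)"
    unfolding nd_def using u xy by (intro chi_mult_finsum[symmetric]) auto
  finally show ?thesis using u by (simp add: gauss_power)
qed

section \<open>Distance counts and their passage to the frequency side\<close>

definition \<nu> :: "(nat \<Rightarrow> 'a) set \<Rightarrow> (nat \<Rightarrow> 'a) \<Rightarrow> 'a \<Rightarrow> nat" where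
  "\<nu> A y t = card {x \<in> A. nd x y = t}"

definition H :: "(nat \<Rightarrow> 'a) set \<Rightarrow> 'a \<Rightarrow> (nat \<Rightarrow> 'a) \<Rightarrow> complex" where
  "H A v y = (\<Sum>x\<in>A. \<chi> (v \<otimes> nd x y))"

definition hat :: "(nat \<Rightarrow> 'a) set \<Rightarrow> (nat \<Rightarrow> 'a) \<Rightarrow> complex" where
  "hat A m = (\<Sum>x\<in>A. cnj (\<chi> (dot m x)))"

definition G :: "(nat \<Rightarrow> 'a) set \<Rightarrow> 'a \<Rightarrow> (nat \<Rightarrow> 'a) \<Rightarrow> complex" where
  "G A r y = (\<Sum>m\<in>ff_sphere F n r. \<chi> (dot m y) * hat A m)"

text \<open>The link between distances and radii. As a function of \<open>u\<close> it is the
  Fourier transform of \<open>G A r y\<close> in \<open>r\<close>, by sorting frequencies according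
  to \<open>nrm\<close>; for nonzero \<open>u\<close> it is also, up to a constant and a change of
  parameter, the Fourier transform \<open>H\<close> of the distance counts.\<close>

definition W :: "(nat \<Rightarrow> 'a) set \<Rightarrow> 'a \<Rightarrow> (nat \<Rightarrow> 'a) \<Rightarrow> complex" where
  "W A u y = (\<Sum>m\<in>V. \<chi> (u \<otimes> nrm m) * \<chi> (dot m y) * hat A m)"

lemma W_expand: "W A u y = (\<Sum>x\<in>A. \<Sum>m\<in>V. \<chi> (u \<otimes> nrm m) * \<chi> (dot m y) * cnj (\<chi> (dot m x)))"
  unfolding W_def hat_def sum_distrib_left by (rule sum.swap)

lemma W_eq_H:
  assumes "A \<subseteq> V" "y \<in> V" "u \<in> carrier F" "u \<noteq> \<zero>"
  shows "W A u y = - of_nat (q ^ k) * H A (\<ominus> (quarter \<otimes> inv u)) y"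
  unfolding W_expand H_def sum_distrib_left using assms
  by (intro sum.cong refl sum_chi_nrm) auto

lemma W_zero:
  assumes "A \<subseteq> V" "y \<in> V"
  shows "W A \<zero> y = (if y \<in> A then of_nat (q ^ n) else 0)"
proof -
  have "W A \<zero> y = (\<Sum>x\<in>A. \<Sum>m\<in>V. \<chi> (dot m y) * cnj (\<chi> (dot m x)))"
    unfolding W_expand by (intro sum.cong refl) simp
  also have "\<dots> = (\<Sum>x\<in>A. if y = x then of_nat (q ^ n) else 0)"
    using assms by (intro sum.cong refl sum_chi_dot) auto
  also have "\<dots> = (if y \<in> A then of_nat (q ^ n) else 0)"
    using finite_subset[OF assms(1)] by simp
  finally show ?thesis .
qed

lemma W_eq_G: "W A u y = (\<Sum>r\<in>carrier F. \<chi> (u \<otimes> r) * G A r y)"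
proof -
  have "W A u y = (\<Sum>r\<in>carrier F. \<Sum>m\<in>{m \<in> V. nrm m = r}. \<chi> (u \<otimes> nrm m) * \<chi> (dot m y) * hat A m)"
    unfolding W_def using finite_carrier by (intro sum.group[symmetric]) auto
  also have "\<dots> = (\<Sum>r\<in>carrier F. \<chi> (u \<otimes> r) * G A r y)"
    unfolding G_def sphere_eq sum_distrib_left by (intro sum.cong refl) (auto simp: mult.assoc)
  finally show ?thesis .
qed

lemma H_eq_nu:
  assumes "A \<subseteq> V" "y \<in> V"
  shows "H A v y = (\<Sum>t\<in>carrier F. \<chi> (v \<otimes> t) * of_nat (\<nu> A y t))"
proof -
  have "H A v y = (\<Sum>t\<in>carrier F. \<Sum>x\<in>{x \<in> A. nd x y = t}. \<chi> (v \<otimes> nd x y))"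
    unfolding H_def using finite_carrier finite_subset[OF assms(1)] assms
    by (intro sum.group[symmetric]) auto
  also have "\<dots> = (\<Sum>t\<in>carrier F. \<Sum>x\<in>{x \<in> A. nd x y = t}. \<chi> (v \<otimes> t))"
    by (intro sum.cong refl) auto
  finally show ?thesis by (simp add: \<nu>_def mult.commute)
qed

lemma H_zero:
  assumes "A \<subseteq> V" "y \<in> V"
  shows "H A \<zero> y = of_nat (card A)"
proof -
  have "H A \<zero> y = (\<Sum>x\<in>A. 1)"
    unfolding H_def using assms by (intro sum.cong refl) (auto simp: subset_iff)
  then show ?thesis by simp
qed

lemma sum_nu:
  assumes "A \<subseteq> V" "y \<in> V"
  shows "(\<Sum>t\<in>carrier F. \<nu> A y t) = card A"
  using H_eq_nu[OF assms, of \<zero>] H_zero[OF assms] by (simp flip: of_nat_sum)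

lemma field_plancherel:
  "(\<Sum>u\<in>carrier F. (norm (\<Sum>r\<in>carrier F. \<chi> (u \<otimes> r) * g r))\<^sup>2) = real q * (\<Sum>r\<in>carrier F. (norm (g r))\<^sup>2)"
proof (rule norm_sum_mult_sq[OF finite_carrier finite_carrier])
  fix r r' assume r: "r \<in> carrier F" "r' \<in> carrier F"
  have "(\<Sum>u\<in>carrier F. \<chi> (u \<otimes> r) * cnj (\<chi> (u \<otimes> r'))) = (\<Sum>u\<in>carrier F. \<chi> (u \<otimes> (r \<ominus> r')))"
    using r by (intro sum.cong refl)
      (simp add: minus_eq r_distr r_minus chi_add chi_uminus)
  then show "(\<Sum>u\<in>carrier F. \<chi> (u \<otimes> r) * cnj (\<chi> (u \<otimes> r'))) = (if r = r' then of_real (real q) else 0)"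
    using r by (simp add: sum_chi_mult minus_eq_zero_iff)
qed

lemma field_inversion:
  "(\<Sum>u\<in>carrier F. \<Sum>r\<in>carrier F. \<chi> (u \<otimes> r) * g r) = of_nat q * g \<zero>"
proof -
  have "(\<Sum>u\<in>carrier F. \<Sum>r\<in>carrier F. \<chi> (u \<otimes> r) * g r) = (\<Sum>r\<in>carrier F. (\<Sum>u\<in>carrier F. \<chi> (u \<otimes> r)) * g r)"
    by (subst sum.swap) (simp add: sum_distrib_right)
  also have "\<dots> = (\<Sum>r\<in>carrier F. if r = \<zero> then of_nat q * g r else 0)"
    by (intro sum.cong refl) (simp add: sum_chi_mult)
  finally show ?thesis using finite_carrier by simp
qed

lemma dot_commute: "x \<in> V \<Longrightarrow> y \<in> V \<Longrightarrow> dot x y = dot y x"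
  unfolding ff_dot_def by (intro finsum_cong) (auto simp: simp_implies_def m_comm)

text \<open>The dual parameter \<open>-1/(4u)\<close> from \<open>sum_chi_nrm\<close> runs over all
  nonzero elements, so that sums of \<open>W\<close> can be rewritten as sums of
  \<open>H\<close>.\<close>

lemma bij_betw_neg_quarter_inv:
  "bij_betw (\<lambda>u. \<ominus> (quarter \<otimes> inv u)) (carrier F - {\<zero>}) (carrier F - {\<zero>})"
proof -
  have "inj_on (\<lambda>u. \<ominus> (quarter \<otimes> inv u)) (carrier F - {\<zero>})"
  proof (rule inj_onI)
    fix u v assume uv: "u \<in> carrier F - {\<zero>}" "v \<in> carrier F - {\<zero>}"
      "\<ominus> (quarter \<otimes> inv u) = \<ominus> (quarter \<otimes> inv v)"
    then have "quarter \<otimes> inv u = quarter \<otimes> inv v"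
      by (metis DiffE inv_closed_nz m_closed minus_minus quarter_closed singletonI)
    then have "inv u = inv v" using uv by (simp add: m_lcancel)
    then show "u = v" using uv by (metis DiffE inv_inv_nz singletonI)
  qed
  moreover have "(\<lambda>u. \<ominus> (quarter \<otimes> inv u)) ` (carrier F - {\<zero>}) \<subseteq> carrier F - {\<zero>}"
  proof (intro image_subsetI)
    fix u assume "u \<in> carrier F - {\<zero>}"
    then show "\<ominus> (quarter \<otimes> inv u) \<in> carrier F - {\<zero>}"
      using uminus_nz[of "quarter \<otimes> inv u"] by (simp add: integral_iff)
  qed
  ultimately show ?thesis
    unfolding bij_betw_def using endo_inj_surj finite_carrier by blast
qed

lemma sum_split_zero:
  fixes f :: "'a \<Rightarrow> 'b::comm_monoid_add"
  shows "(\<Sum>u\<in>carrier F. f u) = f \<zero> + (\<Sum>u\<in>carrier F - {\<zero>}. f u)"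
  using finite_carrier by (intro sum.remove) auto

lemma q_pos [simp]: "q > 0" "q \<noteq> 0"
  using q_ge_3 by auto

lemma q_power_n: "real q ^ n = (real q ^ k)\<^sup>2"
  by (simp add: n_eq power_even_eq)

text \<open>Plancherel is applied twice, in \<open>t\<close> for \<open>H\<close> and in
  \<open>r\<close> for \<open>W\<close>; at nonzero frequencies \<open>W\<close> and
  \<open>H\<close> agree in modulus up to the factor \<open>q ^ k\<close>. The frequency zero of
  \<open>H\<close> yields the main term.\<close>

lemma sum_nu_sq_le:
  assumes "A \<subseteq> V" "y \<in> V"
  shows "(\<Sum>t\<in>carrier F. (real (\<nu> A y t))\<^sup>2) \<le>
    (real (card A))\<^sup>2 / q + (\<Sum>r\<in>carrier F. (norm (G A r y))\<^sup>2) / q ^ n"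
proof -
  have "real (q ^ n) * (\<Sum>v\<in>carrier F - {\<zero>}. (norm (H A v y))\<^sup>2)
      = real (q ^ n) * (\<Sum>u\<in>carrier F - {\<zero>}. (norm (H A (\<ominus> (quarter \<otimes> inv u)) y))\<^sup>2)"
    by (subst sum.reindex_bij_betw[OF bij_betw_neg_quarter_inv]) simp
  also have "\<dots> = (\<Sum>u\<in>carrier F - {\<zero>}. (norm (W A u y))\<^sup>2)"
    unfolding sum_distrib_left using assms
    by (intro sum.cong refl)
      (simp add: W_eq_H norm_mult norm_power power_mult_distrib q_power_n)
  also have "\<dots> \<le> (\<Sum>u\<in>carrier F. (norm (W A u y))\<^sup>2)"
    using finite_carrier by (intro sum_mono2) auto
  also have "\<dots> = real q * (\<Sum>r\<in>carrier F. (norm (G A r y))\<^sup>2)"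
    unfolding W_eq_G by (rule field_plancherel)
  finally have 1: "(\<Sum>v\<in>carrier F - {\<zero>}. (norm (H A v y))\<^sup>2) \<le> q * (\<Sum>r\<in>carrier F. (norm (G A r y))\<^sup>2) / q ^ n"
    by (simp add: field_simps)
  have "real q * (\<Sum>t\<in>carrier F. (real (\<nu> A y t))\<^sup>2) = (\<Sum>v\<in>carrier F. (norm (H A v y))\<^sup>2)"
    unfolding H_eq_nu[OF assms] field_plancherel by simp
  also have "\<dots> = (real (card A))\<^sup>2 + (\<Sum>v\<in>carrier F - {\<zero>}. (norm (H A v y))\<^sup>2)"
    by (simp add: sum_split_zero H_zero assms)
  also have "\<dots> \<le> (real (card A))\<^sup>2 + q * (\<Sum>r\<in>carrier F. (norm (G A r y))\<^sup>2) / q ^ n"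
    using 1 by simp
  finally show ?thesis by (simp add: field_simps)
qed

text \<open>Both \<open>\<nu> A y \<zero>\<close> and \<open>G A \<zero> y\<close> are values at
  zero, which inversion recovers from the sums of \<open>H\<close> and of \<open>W\<close>. These
  sums differ by the factor \<open>- q ^ k\<close> away from frequency zero, and the frequency zero
  is treated by hand.\<close>

lemma G_zero:
  assumes "A \<subseteq> V" "y \<in> V"
  shows "of_nat q * G A \<zero> y = of_real (of_bool (y \<in> A) * q ^ n - q ^ k * (q * real (\<nu> A y \<zero>) - card A))"
proof -
  have "of_nat q * of_nat (\<nu> A y \<zero>) = (\<Sum>v\<in>carrier F. H A v y)"
    unfolding H_eq_nu[OF assms] by (rule field_inversion[symmetric])
  also have "\<dots> = of_nat (card A) + (\<Sum>v\<in>carrier F - {\<zero>}. H A v y)"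
    by (simp add: sum_split_zero H_zero assms)
  finally have 1: "(\<Sum>v\<in>carrier F - {\<zero>}. H A v y) = of_nat q * of_nat (\<nu> A y \<zero>) - of_nat (card A)"
    by simp
  have "of_nat q * G A \<zero> y = (\<Sum>u\<in>carrier F. W A u y)"
    unfolding W_eq_G by (rule field_inversion[symmetric])
  also have "\<dots> = of_bool (y \<in> A) * of_nat (q ^ n) + (\<Sum>u\<in>carrier F - {\<zero>}. W A u y)"
    by (simp add: sum_split_zero W_zero assms)
  also have "(\<Sum>u\<in>carrier F - {\<zero>}. W A u y) =
      (\<Sum>u\<in>carrier F - {\<zero>}. - of_nat (q ^ k) * H A (\<ominus> (quarter \<otimes> inv u)) y)"
    using assms by (intro sum.cong refl W_eq_H) auto
  also have "\<dots> = - of_nat (q ^ k) * (\<Sum>v\<in>carrier F - {\<zero>}. H A v y)"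
    unfolding sum_distrib_left by (subst sum.reindex_bij_betw[OF bij_betw_neg_quarter_inv]) simp
  finally show ?thesis unfolding 1 by simp
qed

text \<open>The isotropic frequencies contribute essentially \<open>\<nu> A y \<zero>\<close> squared, so that they are absorbed
  by leaving out \<open>t = \<zero>\<close>. This uses the sign of the Gauss sum, that is, \<open>odd k\<close>.\<close>

lemma sum_nu_sq_nonzero_le:
  assumes "A \<subseteq> V" "y \<in> V"
  shows "(\<Sum>t\<in>carrier F - {\<zero>}. (real (\<nu> A y t))\<^sup>2) \<le>
    (real (card A))\<^sup>2 / q + 2 * of_bool (y \<in> A) * real q ^ n / (real q)\<^sup>2 + 2 * (real (card A))\<^sup>2 / q\<^sup>2
      + (\<Sum>r\<in>carrier F - {\<zero>}. (norm (G A r y))\<^sup>2) / q ^ n"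
proof -
  define I where "I = (of_bool (y \<in> A) :: real)"
  have I: "I \<ge> 0" "I\<^sup>2 = I" by (auto simp: I_def)
  \<comment> \<open>Chosen so that \<open>G A \<zero> y\<close> equals \<open>q ^ k\<close> times
    \<open>b - \<nu> A y \<zero>\<close>.\<close>
  define b where "b = (q ^ k * I + card A) / q"
  have b: "b \<ge> 0" using I by (simp add: b_def)
  have "real q * norm (G A \<zero> y) = norm (of_nat q * G A \<zero> y)" by (simp add: norm_mult)
  also have "\<dots> = \<bar>I * q ^ n - q ^ k * (q * real (\<nu> A y \<zero>) - card A)\<bar>"
    unfolding G_zero[OF assms] norm_of_real I_def by simp
  also have "I * q ^ n - q ^ k * (q * real (\<nu> A y \<zero>) - card A) = q * (q ^ k * (b - \<nu> A y \<zero>))"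
    by (simp add: b_def field_simps q_power_n power2_eq_square)
  finally have "norm (G A \<zero> y) = \<bar>q ^ k * (b - \<nu> A y \<zero>)\<bar>"
    by (simp add: abs_mult)
  then have "(norm (G A \<zero> y))\<^sup>2 / q ^ n = (b - \<nu> A y \<zero>)\<^sup>2"
    by (simp add: power_mult_distrib q_power_n)
  \<comment> \<open>The cross term is nonpositive, since \<open>b\<close> and the count are both
    nonnegative. Hence the square of the count appears with coefficient one and cancels the term
    \<open>t = \<zero>\<close> exactly.\<close>
  also have "\<dots> \<le> b\<^sup>2 + (real (\<nu> A y \<zero>))\<^sup>2"
    using b by (simp add: power2_diff)
  also have "b\<^sup>2 \<le> 2 * I * q ^ n / q\<^sup>2 + 2 * (real (card A))\<^sup>2 / q\<^sup>2"
  proof -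
    have "(q ^ k * I + card A)\<^sup>2 \<le> 2 * (q ^ k * I)\<^sup>2 + 2 * (real (card A))\<^sup>2"
      using sum_squares_bound[of "q ^ k * I" "card A"] by (simp add: power2_sum)
    also have "(q ^ k * I)\<^sup>2 = I * q ^ n" by (simp add: power_mult_distrib I q_power_n)
    finally show ?thesis
      unfolding b_def power_divide add_divide_distrib[symmetric] of_nat_power
      by (intro divide_right_mono) (simp_all add: mult.assoc)
  qed
  finally have 0: "(norm (G A \<zero> y))\<^sup>2 / q ^ n \<le>
      2 * I * q ^ n / q\<^sup>2 + 2 * (real (card A))\<^sup>2 / q\<^sup>2 + (real (\<nu> A y \<zero>))\<^sup>2" by simp
  show ?thesis
    using sum_nu_sq_le[OF assms] 0
    unfolding sum_split_zero add_divide_distrib I_def of_nat_power by linarith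
qed

section \<open>Sphere sizes and the use of the extension estimate\<close>

text \<open>Detecting \<open>nrm m = r\<close> by characters, the frequency zero gives
  \<open>q ^ n\<close>. Each of the other frequencies gives a Gauss sum of modulus
  \<open>q ^ k\<close>, and \<open>k + 1 \<le> 2 k\<close> bounds their total by
  \<open>q ^ n\<close> again.\<close>

lemma card_sphere_le: "q * card (ff_sphere F n r) \<le> 2 * q ^ n" if r: "r \<in> carrier F"
proof (cases "ff_sphere F n r = {}")
  case False
  then obtain x where x: "x \<in> V" by (auto simp: sphere_eq)
  have S: "of_nat (q * card (ff_sphere F n r)) =
      (\<Sum>u\<in>carrier F. \<Sum>m\<in>V. \<chi> (u \<otimes> nrm m) * cnj (\<chi> (u \<otimes> r)))"
  proof -
    have "(\<Sum>u\<in>carrier F. \<Sum>m\<in>V. \<chi> (u \<otimes> nrm m) * cnj (\<chi> (u \<otimes> r)))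
       = (\<Sum>m\<in>V. \<Sum>u\<in>carrier F. \<chi> (u \<otimes> (nrm m \<ominus> r)))"
      using r by (subst sum.swap, intro sum.cong refl)
        (simp add: minus_eq r_distr r_minus chi_add chi_uminus)
    also have "\<dots> = (\<Sum>m\<in>V. if nrm m = r then of_nat q else 0)"
      using r by (intro sum.cong refl) (simp add: sum_chi_mult minus_eq_zero_iff)
    also have "\<dots> = of_nat (q * card (ff_sphere F n r))"
      by (simp add: sphere_eq sum.If_cases Int_def mult.commute)
    finally show ?thesis ..
  qed
  have nb: "norm (\<Sum>m\<in>V. \<chi> (u \<otimes> nrm m) * cnj (\<chi> (u \<otimes> r))) = real q ^ k"
    if u: "u \<in> carrier F - {\<zero>}" for u
  proof -
    \<comment> \<open>Inserting \<open>\<chi> (dot m x)\<close> and its conjugate, whose product is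
      one, brings the sum into the form of \<open>sum_chi_nrm\<close> with both points equal to
      \<open>x\<close>.\<close>
    have "(\<Sum>m\<in>V. \<chi> (u \<otimes> nrm m) * cnj (\<chi> (u \<otimes> r))) =
       (\<Sum>m\<in>V. \<chi> (u \<otimes> nrm m) * \<chi> (dot m x) * cnj (\<chi> (dot m x))) * cnj (\<chi> (u \<otimes> r))"
      unfolding sum_distrib_right using x
      by (intro sum.cong refl) (simp add: mult.assoc complex_norm_square[symmetric])
    also have "norm \<dots> = real q ^ k"
      using u x r by (simp add: sum_chi_nrm norm_mult norm_power)
    finally show ?thesis .
  qed
  have "real (q * card (ff_sphere F n r)) = norm (complex_of_real (real (q * card (ff_sphere F n r))))"
    by (simp only: norm_of_real abs_of_nat)
  also have "complex_of_real (real (q * card (ff_sphere F n r))) =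
     (\<Sum>m\<in>V. \<chi> (\<zero> \<otimes> nrm m) * cnj (\<chi> (\<zero> \<otimes> r))) +
       (\<Sum>u\<in>carrier F - {\<zero>}. \<Sum>m\<in>V. \<chi> (u \<otimes> nrm m) * cnj (\<chi> (u \<otimes> r)))"
    using S by (simp add: sum_split_zero)
  also have "(\<Sum>m\<in>V. \<chi> (\<zero> \<otimes> nrm m) * cnj (\<chi> (\<zero> \<otimes> r))) = of_nat (q ^ n)"
    using r by (simp add: card_V)
  also have "norm (of_nat (q ^ n) + (\<Sum>u\<in>carrier F - {\<zero>}. \<Sum>m\<in>V. \<chi> (u \<otimes> nrm m) * cnj (\<chi> (u \<otimes> r))))
     \<le> real (q ^ n) + (\<Sum>u\<in>carrier F - {\<zero>}. real q ^ k)"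
    using nb by (intro norm_triangle_mono sum_norm_le) (auto simp: norm_power)
  also have "(\<Sum>u\<in>carrier F - {\<zero>}. real q ^ k) \<le> real q * real q ^ k"
    using finite_carrier by (simp add: card_Diff_singleton mult_right_mono)
  also have "real q * real q ^ k \<le> real q ^ n"
    using odd_k q_ge_3 unfolding power_Suc[symmetric] n_eq
    by (intro power_increasing) (auto elim!: oddE)
  finally have "real (q * card (ff_sphere F n r)) \<le> real (2 * q ^ n)" by simp
  then show ?thesis by (simp only: of_nat_le_iff)
qed simp

lemma sum_norm_hat:
  assumes "A \<subseteq> V"
  shows "(\<Sum>m\<in>V. (norm (hat A m))\<^sup>2) = real q ^ n * card A"
proof -
  have "(\<Sum>m\<in>V. (norm (\<Sum>x\<in>A. cnj (\<chi> (dot m x)) * 1))\<^sup>2) = real q ^ n * (\<Sum>x\<in>A. (norm (1::complex))\<^sup>2)"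
  proof (rule norm_sum_mult_sq)
    fix r r' assume "r \<in> A" "r' \<in> A"
    then show "(\<Sum>u\<in>V. cnj (\<chi> (dot u r)) * cnj (cnj (\<chi> (dot u r')))) = (if r = r' then complex_of_real (real q ^ n) else 0)"
      using sum_chi_dot[of r r'] assms by (auto simp: mult.commute subset_iff)
  qed (use finite_subset[OF assms] in auto)
  then show ?thesis by (simp add: hat_def)
qed

lemma sum_norm_G:
  "(\<Sum>y\<in>V. (norm (G A r y))\<^sup>2) = real q ^ n * (\<Sum>m\<in>ff_sphere F n r. (norm (hat A m))\<^sup>2)"
  unfolding G_def
proof (rule norm_sum_mult_sq)
  fix m m' assume m: "m \<in> ff_sphere F n r" "m' \<in> ff_sphere F n r"
  then have "(\<Sum>y\<in>V. \<chi> (dot m y) * cnj (\<chi> (dot m' y))) = (\<Sum>y\<in>V. \<chi> (dot y m) * cnj (\<chi> (dot y m')))"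
    by (intro sum.cong refl) (auto simp: sphere_eq dot_commute)
  then show "(\<Sum>y\<in>V. \<chi> (dot m y) * cnj (\<chi> (dot m' y))) = (if m = m' then complex_of_real (real q ^ n) else 0)"
    using m sum_chi_dot[of m' m] by (auto simp: sphere_eq)
qed auto

lemma sphere_extension_hat:
  assumes "y \<in> V"
  shows "G A r y = of_nat (card (ff_sphere F n r)) * sphere_extension F \<chi> n r (hat A) y"
proof -
  have "G A r y = (\<Sum>x\<in>ff_sphere F n r. \<chi> (dot y x) * hat A x)"
    unfolding G_def using assms by (intro sum.cong refl) (auto simp: sphere_eq dot_commute)
  then show ?thesis
    by (cases "ff_sphere F n r = {}") (auto simp: sphere_extension_def card_eq_0_iff)
qed

text \<open>Hoelder on \<open>B\<close> with \<open>s = (n + 2)/n\<close>, chosen so that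
  \<open>2 s\<close> is the exponent \<open>(2d + 2)/(d - 1)\<close> of the estimate for
  \<open>d = n + 1\<close>. Undoing the normalisation of the measure costs the square of the sphere
  size, of which the \<open>L2\<close> norm on the right gives one factor back.\<close>

lemma sum_norm_G_le:
  assumes ext: "sphere_extension_estimate F \<chi> (n + 1) C0"
    and r: "r \<in> carrier F - {\<zero>}" and B: "B \<subseteq> V"
  shows "(\<Sum>y\<in>B. (norm (G A r y))\<^sup>2) \<le> real (card B) powr (2 / (n + 2)) *
    (C0\<^sup>2 * (card (ff_sphere F n r) * (\<Sum>m\<in>ff_sphere F n r. (norm (hat A m))\<^sup>2)))"
proof -
  define S where "S = real (card (ff_sphere F n r))"
  define e where "e y = norm (sphere_extension F \<chi> n r (hat A) y)" for y
  define p where "p = (2 * real (n + 1) + 2) / (real (n + 1) - 1)"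
  define s where "s = real (n + 2) / n"
  define X where "X = (\<Sum>y\<in>V. e y powr p)"
  define M where "M = (\<Sum>m\<in>ff_sphere F n r. (norm (hat A m))\<^sup>2)"
  have n: "real n > 0" using odd_k n_eq by (auto elim!: oddE)
  have ps: "p = 2 * s" "1 / p = 1 / s / 2" "1 - 1 / s = 2 / (n + 2)" "s \<ge> 1"
    using n by (auto simp: p_def s_def field_simps)
  have M: "M \<ge> 0" "S \<ge> 0" by (auto simp: M_def S_def sum_nonneg)
  have "X powr (1 / p) \<le> C0 * sqrt (inverse S * M)"
    using ext r unfolding sphere_extension_estimate_def X_def p_def e_def S_def M_def by simp
  moreover have "0 \<le> X powr (1 / p)" by simp
  ultimately have "(X powr (1 / p))\<^sup>2 \<le> (C0 * sqrt (inverse S * M))\<^sup>2"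
    by (rule power_mono)
  also have "(X powr (1 / p))\<^sup>2 = X powr (1 / s)"
    unfolding ps(2) by (simp add: power2_eq_square powr_add[symmetric])
  also have "(C0 * sqrt (inverse S * M))\<^sup>2 = C0\<^sup>2 * (inverse S * M)"
    using M by (simp add: power_mult_distrib)
  finally have X: "X powr (1 / s) \<le> C0\<^sup>2 * (inverse S * M)" .
  have "(\<Sum>y\<in>B. (e y)\<^sup>2) \<le> real (card B) powr (1 - 1 / s) * (\<Sum>y\<in>B. ((e y)\<^sup>2) powr s) powr (1 / s)"
    using ps B finite_subset[OF B] by (intro sum_le_card_powr_holder) auto
  also have "(\<Sum>y\<in>B. ((e y)\<^sup>2) powr s) = (\<Sum>y\<in>B. e y powr p)"
  proof (intro sum.cong refl)
    fix y
    show "((e y)\<^sup>2) powr s = e y powr p"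
    proof (cases "e y = 0")
      case False
      then have "e y > 0" by (simp add: e_def)
      then show ?thesis unfolding ps(1) by (simp add: powr_powr flip: powr_numeral)
    qed simp
  qed
  also have "(\<Sum>y\<in>B. e y powr p) powr (1 / s) \<le> X powr (1 / s)"
    unfolding X_def using B n by (intro powr_mono2 sum_mono2 sum_nonneg) (auto simp: s_def)
  also note X
  finally have 1: "(\<Sum>y\<in>B. (e y)\<^sup>2) \<le> real (card B) powr (2 / (n + 2)) * (C0\<^sup>2 * (inverse S * M))"
    unfolding ps(3) by (simp add: mult_left_mono)
  have "(\<Sum>y\<in>B. (norm (G A r y))\<^sup>2) = S\<^sup>2 * (\<Sum>y\<in>B. (e y)\<^sup>2)"
    unfolding sum_distrib_left using B
    by (intro sum.cong refl)
      (auto simp: sphere_extension_hat S_def e_def norm_mult power_mult_distrib)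
  also have "\<dots> \<le> S\<^sup>2 * (real (card B) powr (2 / (n + 2)) * (C0\<^sup>2 * (inverse S * M)))"
    by (intro mult_left_mono 1) simp
  \<comment> \<open>For an empty sphere this still holds, as \<open>inverse 0 = 0\<close>.\<close>
  also have "\<dots> = real (card B) powr (2 / (n + 2)) * (C0\<^sup>2 * (S * M))"
    by (simp add: power2_eq_square field_simps)
  finally show ?thesis unfolding S_def M_def .
qed

section \<open>Energy of pinned distances and the Cauchy-Schwarz argument\<close>

text \<open>The pointwise bound is summed over the pins. Spheres of nonzero radius have at most
  \<open>2 q ^ n / q\<close> points and together carry at most the full \<open>L2\<close> mass
  \<open>q ^ n * N\<close> of \<open>hat A\<close>, so \<open>N2\<close> turns their share into
  \<open>2 * C0\<^sup>2 * N ^ 3 / q\<close>.\<close>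

lemma pinned_energy_le:
  assumes ext: "sphere_extension_estimate F \<chi> (n + 1) C0"
    and AB: "A \<subseteq> V" "B \<subseteq> V" "card A = N" "card B = N"
    and N1: "8 * real q ^ k \<le> N" and N2: "real q ^ n * N powr (2 / (n + 2)) \<le> N\<^sup>2"
  shows "(\<Sum>y\<in>B. \<Sum>t\<in>carrier F - {\<zero>}. (real (\<nu> A y t))\<^sup>2) \<le> (3 + 2 * C0\<^sup>2) * real N ^ 3 / q"
proof -
  define L where "L = real N powr (2 / (n + 2))"
  have L: "L \<ge> 0" by (simp add: L_def)
  have "(\<Sum>r\<in>carrier F - {\<zero>}. \<Sum>y\<in>B. (norm (G A r y))\<^sup>2) \<le>
     (\<Sum>r\<in>carrier F - {\<zero>}. L * (C0\<^sup>2 * (2 * q ^ n / q * (\<Sum>m\<in>ff_sphere F n r. (norm (hat A m))\<^sup>2))))"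
  proof (intro sum_mono)
    fix r assume r: "r \<in> carrier F - {\<zero>}"
    have "real (q * card (ff_sphere F n r)) \<le> real (2 * q ^ n)"
      using card_sphere_le[of r] r by (simp only: of_nat_le_iff) simp
    then have "real (card (ff_sphere F n r)) \<le> 2 * q ^ n / q"
      by (simp add: field_simps)
    then have "L * (C0\<^sup>2 * (card (ff_sphere F n r) * (\<Sum>m\<in>ff_sphere F n r. (norm (hat A m))\<^sup>2))) \<le>
       L * (C0\<^sup>2 * (2 * q ^ n / q * (\<Sum>m\<in>ff_sphere F n r. (norm (hat A m))\<^sup>2)))"
      using L by (intro mult_left_mono mult_right_mono sum_nonneg) auto
    with sum_norm_G_le[OF ext r AB(2), of A] AB(4)
    show "(\<Sum>y\<in>B. (norm (G A r y))\<^sup>2) \<le> L * (C0\<^sup>2 * (2 * q ^ n / q * (\<Sum>m\<in>ff_sphere F n r. (norm (hat A m))\<^sup>2)))"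
      unfolding L_def by simp
  qed
  also have "\<dots> = L * (C0\<^sup>2 * (2 * q ^ n / q * (\<Sum>r\<in>carrier F - {\<zero>}. \<Sum>m\<in>ff_sphere F n r. (norm (hat A m))\<^sup>2)))"
    by (simp add: sum_distrib_left)
  also have "\<dots> \<le> L * (C0\<^sup>2 * (2 * q ^ n / q * (real q ^ n * N)))"
  proof -
    have "(\<Sum>r\<in>carrier F - {\<zero>}. \<Sum>m\<in>ff_sphere F n r. (norm (hat A m))\<^sup>2) \<le>
       (\<Sum>r\<in>carrier F. \<Sum>m\<in>ff_sphere F n r. (norm (hat A m))\<^sup>2)"
      using finite_carrier by (intro sum_mono2 sum_nonneg) auto
    also have "\<dots> = (\<Sum>m\<in>V. (norm (hat A m))\<^sup>2)"
      unfolding sphere_eq using finite_carrier by (intro sum.group) auto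
    also have "\<dots> = real q ^ n * N" using sum_norm_hat[OF AB(1)] AB by simp
    finally show ?thesis using L by (intro mult_left_mono) auto
  qed
  finally have R: "(\<Sum>r\<in>carrier F - {\<zero>}. \<Sum>y\<in>B. (norm (G A r y))\<^sup>2) / q ^ n \<le> 2 * C0\<^sup>2 * (real q ^ n * L) * N / q"
    by (simp add: field_simps)
  also have "\<dots> \<le> 2 * C0\<^sup>2 * (real N)\<^sup>2 * N / q"
    using N2 unfolding L_def by (intro divide_right_mono mult_right_mono mult_left_mono) auto
  finally have R: "(\<Sum>r\<in>carrier F - {\<zero>}. \<Sum>y\<in>B. (norm (G A r y))\<^sup>2) / q ^ n \<le> 2 * C0\<^sup>2 * real N ^ 3 / q"
    by (simp add: power3_eq_cube power2_eq_square mult.assoc)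
  have "(\<Sum>y\<in>B. \<Sum>t\<in>carrier F - {\<zero>}. (real (\<nu> A y t))\<^sup>2) \<le>
     (\<Sum>y\<in>B. (real N)\<^sup>2 / q + 2 * real q ^ n / (real q)\<^sup>2 + 2 * (real N)\<^sup>2 / (real q)\<^sup>2
      + (\<Sum>r\<in>carrier F - {\<zero>}. (norm (G A r y))\<^sup>2) / q ^ n)"
  proof (intro sum_mono)
    fix y assume "y \<in> B"
    then have y: "y \<in> V" using AB by auto
    have "2 * of_bool (y \<in> A) * real q ^ n / (real q)\<^sup>2 \<le> 2 * real q ^ n / (real q)\<^sup>2"
      by (intro divide_right_mono mult_right_mono mult_left_mono) auto
    then show "(\<Sum>t\<in>carrier F - {\<zero>}. (real (\<nu> A y t))\<^sup>2) \<le> (real N)\<^sup>2 / q + 2 * real q ^ n / (real q)\<^sup>2 + 2 * (real N)\<^sup>2 / (real q)\<^sup>2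
      + (\<Sum>r\<in>carrier F - {\<zero>}. (norm (G A r y))\<^sup>2) / q ^ n"
      using sum_nu_sq_nonzero_le[OF AB(1) y] AB(3) by simp
  qed
  also have "\<dots> = N * ((real N)\<^sup>2 / q + 2 * real q ^ n / (real q)\<^sup>2 + 2 * (real N)\<^sup>2 / (real q)\<^sup>2)
     + (\<Sum>r\<in>carrier F - {\<zero>}. \<Sum>y\<in>B. (norm (G A r y))\<^sup>2) / q ^ n"
  proof -
    have "(\<Sum>y\<in>B. (\<Sum>r\<in>carrier F - {\<zero>}. (norm (G A r y))\<^sup>2) / q ^ n) =
       (\<Sum>r\<in>carrier F - {\<zero>}. \<Sum>y\<in>B. (norm (G A r y))\<^sup>2) / q ^ n"
      by (subst sum.swap) (simp only: sum_divide_distrib)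
    then show ?thesis by (simp add: sum.distrib AB distrib_left)
  qed
  \<comment> \<open>The summand 3 of the constant: the squared form of \<open>N1\<close> controls
    the diagonal term, and \<open>q \<ge> 2\<close> the last one.\<close>
  also have "\<dots> \<le> N * ((real N)\<^sup>2 / q + (real N)\<^sup>2 / q + (real N)\<^sup>2 / q) + 2 * C0\<^sup>2 * real N ^ 3 / q"
  proof (intro add_mono mult_left_mono R order_refl)
    have "(8 * real q ^ k)\<^sup>2 \<le> (real N)\<^sup>2" using N1 by (intro power_mono) auto
    then have a: "64 * real q ^ n \<le> (real N)\<^sup>2" by (simp add: power_mult_distrib q_power_n)
    have "2 * real q ^ n \<le> real q * (real N)\<^sup>2"
      using a q_ge_3 mult_right_mono[of 1 "real q" "(real N)\<^sup>2"] zero_le_power[of "real q" n]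
      by linarith
    then show "2 * real q ^ n / (real q)\<^sup>2 \<le> (real N)\<^sup>2 / q"
      by (simp add: field_simps power2_eq_square)
    have "2 * (real N)\<^sup>2 \<le> real q * (real N)\<^sup>2"
      using q_ge_3 by (intro mult_right_mono) auto
    then show "2 * (real N)\<^sup>2 / (real q)\<^sup>2 \<le> (real N)\<^sup>2 / q"
      by (simp add: field_simps power2_eq_square)
  qed auto
  also have "\<dots> = (3 + 2 * C0\<^sup>2) * real N ^ 3 / q"
    by (simp add: field_simps power3_eq_cube power2_eq_square)
  finally show ?thesis .
qed

text \<open>At most half of all pairs are at distance zero. The counts are controlled by
  \<open>G A \<zero> y\<close> through \<open>G_zero\<close>, and Cauchy-Schwarz on \<open>B\<close>
  with Plancherel on the whole space suffices for the isotropic sphere, where the extension estimate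
  says nothing.\<close>

lemma zero_distance_count_le:
  assumes AB: "A \<subseteq> V" "B \<subseteq> V" "card A = N" "card B = N"
    and N1: "8 * real q ^ k \<le> N"
  shows "(\<Sum>y\<in>B. real (\<nu> A y \<zero>)) \<le> (real N)\<^sup>2 / 2"
proof -
  define Z where "Z = (\<Sum>y\<in>B. real (\<nu> A y \<zero>))"
  have G0: "(\<Sum>y\<in>B. norm (G A \<zero> y)) \<le> real q ^ n * real N"
  proof -
    have "(\<Sum>y\<in>B. norm (G A \<zero> y))\<^sup>2 \<le> (\<Sum>y\<in>B. (norm (G A \<zero> y))\<^sup>2) * card B"
      by (rule sum_squared_le_sum_of_squares)
    also have "(\<Sum>y\<in>B. (norm (G A \<zero> y))\<^sup>2) \<le> (\<Sum>y\<in>V. (norm (G A \<zero> y))\<^sup>2)"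
      using AB by (intro sum_mono2) auto
    also have "\<dots> = real q ^ n * (\<Sum>m\<in>ff_sphere F n \<zero>. (norm (hat A m))\<^sup>2)"
      by (rule sum_norm_G)
    also have "(\<Sum>m\<in>ff_sphere F n \<zero>. (norm (hat A m))\<^sup>2) \<le> (\<Sum>m\<in>V. (norm (hat A m))\<^sup>2)"
      by (intro sum_mono2) (auto simp: sphere_eq)
    also have "\<dots> = real q ^ n * N" using sum_norm_hat[OF AB(1)] AB by simp
    finally have "(\<Sum>y\<in>B. norm (G A \<zero> y))\<^sup>2 \<le> (real q ^ n * real N)\<^sup>2"
      using AB by (simp add: power2_eq_square mult_ac mult_left_mono mult_right_mono)
    then show ?thesis by (rule power2_le_imp_le) simp
  qed
  have le: "real q * (real q ^ k * \<nu> A y \<zero>) \<le> q ^ n + q ^ k * N + q * norm (G A \<zero> y)" if "y \<in> B" for y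
  proof -
    have y: "y \<in> V" using that AB by auto
    have "norm (of_nat q * G A \<zero> y) = \<bar>of_bool (y \<in> A) * real q ^ n - q ^ k * (q * real (\<nu> A y \<zero>) - N)\<bar>"
      unfolding G_zero[OF AB(1) y] norm_of_real AB by simp
    then have "- (of_bool (y \<in> A) * real q ^ n - q ^ k * (q * real (\<nu> A y \<zero>) - N)) \<le> q * norm (G A \<zero> y)"
      by (simp add: norm_mult)
    then show ?thesis by (cases "y \<in> A") (auto simp: algebra_simps intro: add_increasing)
  qed
  have "real q * (real q ^ k * Z) = (\<Sum>y\<in>B. real q * (real q ^ k * \<nu> A y \<zero>))"
    by (simp add: Z_def sum_distrib_left)
  also have "\<dots> \<le> (\<Sum>y\<in>B. q ^ n + q ^ k * N + q * norm (G A \<zero> y))"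
    by (intro sum_mono le)
  also have "\<dots> = real N * (real q ^ n + real q ^ k * real N) + q * (\<Sum>y\<in>B. norm (G A \<zero> y))"
    by (simp add: sum.distrib AB sum_distrib_left algebra_simps)
  also have "\<dots> \<le> real N * (real q ^ n + real q ^ k * real N) + q * (real q ^ n * real N)"
    using G0 by (intro add_left_mono mult_left_mono) auto
  also have "\<dots> = real q ^ k * (N * (real q ^ k) + real N * N + q * (real q ^ k * N))"
    using q_power_n by (simp add: algebra_simps power2_eq_square)
  finally have "real q * Z \<le> N * (real q ^ k) + real N * N + q * (real q ^ k * N)"
    by (simp add: mult.left_commute)
  also have "\<dots> \<le> N * (N / 8) + real N * N + q * (N / 8 * N)"
    using N1 by (intro add_mono mult_left_mono mult_right_mono) auto
  also have "\<dots> = (real N)\<^sup>2 * (9 / 8 + q / 8)" by (simp add: power2_eq_square field_simps)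
  \<comment> \<open>This is where the factor 8 in \<open>N1\<close> is used: the inequality amounts
    to \<open>q \<ge> 3\<close>, with equality at 3.\<close>
  also have "\<dots> \<le> (real N)\<^sup>2 * (q / 2)" using q_ge_3 by (intro mult_left_mono) auto
  finally show ?thesis unfolding Z_def[symmetric] by (simp add: field_simps)
qed

text \<open>Cauchy-Schwarz in \<open>t\<close>, over the at most \<open>P\<close> distances seen
  from a pin, and then in \<open>y\<close>. Since at least half of the pairs have nonzero distance,
  \<open>N^4/4\<close> is at most \<open>P * N\<close> times the energy bound.\<close>

theorem pinned_distances_ge:
  assumes ext: "sphere_extension_estimate F \<chi> (n + 1) C0"
    and AB: "A \<subseteq> V" "B \<subseteq> V" "card A = N" "card B = N"
    and N1: "8 * real q ^ k \<le> N" and N2: "real q ^ n * N powr (2 / (n + 2)) \<le> N\<^sup>2"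
    and P: "\<And>y. y \<in> B \<Longrightarrow> card ((\<lambda>x. nd x y) ` A) \<le> P"
  shows "real q / (4 * (3 + 2 * C0\<^sup>2)) \<le> P"
proof -
  define K where "K = 3 + 2 * C0\<^sup>2"
  have K: "K > 0" by (auto simp: K_def intro: add_pos_nonneg)
  have N: "real N > 0" using N1 by (rule less_le_trans[rotated]) simp
  have finA: "finite A" using AB finite_subset finite_V by blast
  define s where "s y = (\<Sum>t\<in>carrier F - {\<zero>}. real (\<nu> A y t))" for y
  have s_sq: "(s y)\<^sup>2 \<le> (\<Sum>t\<in>carrier F - {\<zero>}. (real (\<nu> A y t))\<^sup>2) * P" if y: "y \<in> B" for y
  proof -
    define T where "T = (\<lambda>x. nd x y) ` A - {\<zero>}"
    have T: "T \<subseteq> carrier F - {\<zero>}" "finite T" using AB y finA by (auto simp: T_def subset_iff)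
    have z: "\<nu> A y t = 0" if "t \<in> (carrier F - {\<zero>}) - T" for t
      using that finA by (auto simp: \<nu>_def T_def)
    have "s y = (\<Sum>t\<in>T. real (\<nu> A y t))"
      unfolding s_def using T finite_carrier z by (intro sum.mono_neutral_right) auto
    then have "(s y)\<^sup>2 \<le> (\<Sum>t\<in>T. (real (\<nu> A y t))\<^sup>2) * card T"
      by (simp add: sum_squared_le_sum_of_squares)
    also have "\<dots> \<le> (\<Sum>t\<in>carrier F - {\<zero>}. (real (\<nu> A y t))\<^sup>2) * P"
    proof (intro mult_mono sum_mono2 sum_nonneg)
      have "card T \<le> card ((\<lambda>x. nd x y) ` A)" using finA by (auto simp: T_def intro: card_mono)
      then show "real (card T) \<le> P" using P[OF y] by simp
    qed (use T finite_carrier in auto)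
    finally show ?thesis .
  qed
  have "(\<Sum>y\<in>B. s y) = (\<Sum>y\<in>B. real N - \<nu> A y \<zero>)"
  proof (intro sum.cong refl)
    fix y assume "y \<in> B"
    then have "y \<in> V" using AB by auto
    then have "real (\<Sum>t\<in>carrier F. \<nu> A y t) = N" by (simp only: sum_nu AB)
    then show "s y = real N - \<nu> A y \<zero>" by (simp add: sum_split_zero s_def)
  qed
  also have "\<dots> = (real N)\<^sup>2 - (\<Sum>y\<in>B. real (\<nu> A y \<zero>))"
    by (simp add: sum_subtractf AB power2_eq_square)
  finally have "(real N)\<^sup>2 / 2 \<le> (\<Sum>y\<in>B. s y)"
    using zero_distance_count_le[OF AB N1] by simp
  then have "((real N)\<^sup>2 / 2)\<^sup>2 \<le> (\<Sum>y\<in>B. s y)\<^sup>2" by (intro power_mono) auto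
  also have "\<dots> \<le> (\<Sum>y\<in>B. (s y)\<^sup>2) * N"
    using sum_squared_le_sum_of_squares[of s B] AB by simp
  also have "\<dots> \<le> (\<Sum>y\<in>B. (\<Sum>t\<in>carrier F - {\<zero>}. (real (\<nu> A y t))\<^sup>2) * P) * N"
    by (intro mult_right_mono sum_mono s_sq) auto
  also have "\<dots> = (\<Sum>y\<in>B. \<Sum>t\<in>carrier F - {\<zero>}. (real (\<nu> A y t))\<^sup>2) * P * N"
    by (simp add: sum_distrib_right)
  also have "\<dots> \<le> K * real N ^ 3 / q * P * N"
    using pinned_energy_le[OF ext AB N1 N2] by (intro mult_right_mono) (auto simp: K_def)
  finally have "real N ^ 4 * (real q) \<le> real N ^ 4 * (4 * K * P)"
    by (simp add: field_simps eval_nat_numeral)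
  then have "real q \<le> 4 * K * P" using N by simp
  then show ?thesis using K unfolding K_def[symmetric] by (simp add: field_simps)
qed

section \<open>From products on the paraboloid to pinned distances\<close>

lemma nd_eq_nrm_dot:
  assumes "x \<in> V" "y \<in> V"
  shows "nd x y = nrm x \<oplus> nrm y \<ominus> two \<otimes> dot x y"
proof -
  have "nd x y \<oplus> (dot x y \<oplus> dot x y) =
      (\<Oplus>i\<in>{1..n}. (y i \<ominus> x i) \<otimes> (y i \<ominus> x i) \<oplus> (x i \<otimes> y i \<oplus> x i \<otimes> y i))"
    unfolding nd_def ff_dot_def using assms by (subst finsum_addf; (subst finsum_addf)?) auto
  also have "\<dots> = (\<Oplus>i\<in>{1..n}. x i [^] (2::nat) \<oplus> y i [^] (2::nat))"
  proof (intro finsum_cong refl)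
    have "(b \<ominus> a) \<otimes> (b \<ominus> a) \<oplus> (a \<otimes> b \<oplus> a \<otimes> b) = a \<otimes> a \<oplus> b \<otimes> b"
      if "a \<in> carrier F" "b \<in> carrier F" for a b
      using that by algebra
    then show "i \<in> {1..n} =simp=> (y i \<ominus> x i) \<otimes> (y i \<ominus> x i) \<oplus> (x i \<otimes> y i \<oplus> x i \<otimes> y i) =
        x i [^] (2::nat) \<oplus> y i [^] (2::nat)" for i
      using assms unfolding simp_implies_def by (simp add: pow2)
  qed (use assms in auto)
  also have "\<dots> = nrm x \<oplus> nrm y"
    unfolding nrm_def using assms by (subst finsum_addf) auto
  finally have e: "nd x y \<oplus> (dot x y \<oplus> dot x y) = nrm x \<oplus> nrm y" .
  have "nd x y = nd x y \<oplus> (dot x y \<oplus> dot x y) \<ominus> two \<otimes> dot x y"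
    unfolding two_def using nd_closed[OF assms] dot_closed[OF assms] by algebra
  then show ?thesis unfolding e .
qed

definition scale :: "'a \<Rightarrow> (nat \<Rightarrow> 'a) \<Rightarrow> nat \<Rightarrow> 'a" where
  "scale c y = (\<lambda>i\<in>{1..n}. c \<otimes> y i)"

lemma scale_closed: "c \<in> carrier F \<Longrightarrow> y \<in> V \<Longrightarrow> scale c y \<in> V"
  by (auto simp: scale_def ff_vecs_def)

lemma dot_scale:
  assumes "c \<in> carrier F" "x \<in> V" "y \<in> V"
  shows "dot x (scale c y) = c \<otimes> dot x y"
proof -
  have "dot x (scale c y) = (\<Oplus>i\<in>{1..n}. c \<otimes> (x i \<otimes> y i))"
    unfolding ff_dot_def scale_def using assms
    by (intro finsum_cong) (auto simp: simp_implies_def m_lcomm)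
  then show ?thesis
    unfolding ff_dot_def using assms by (subst finsum_rdistr) auto
qed

lemma nrm_scale:
  assumes "c \<in> carrier F" "y \<in> V"
  shows "nrm (scale c y) = c \<otimes> c \<otimes> nrm y"
proof -
  have "nrm (scale c y) = (\<Oplus>i\<in>{1..n}. (c \<otimes> c) \<otimes> (y i [^] (2::nat)))"
    unfolding nrm_def scale_def using assms
    by (intro finsum_cong) (auto simp: simp_implies_def pow2 m_ac)
  then show ?thesis
    unfolding nrm_def using assms by (subst finsum_rdistr) auto
qed

text \<open>The dot product of the points of the paraboloid lying above \<open>x\<close> and
  \<open>y\<close>.\<close>

definition par_prod :: "(nat \<Rightarrow> 'a) \<Rightarrow> (nat \<Rightarrow> 'a) \<Rightarrow> 'a" where
  "par_prod x y = dot x y \<oplus> nrm x \<otimes> nrm y"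

definition invert :: "(nat \<Rightarrow> 'a) \<Rightarrow> nat \<Rightarrow> 'a" where
  "invert y = scale (\<ominus> (inv (two \<otimes> nrm y))) y"

lemma invert_closed: "y \<in> V \<Longrightarrow> nrm y \<noteq> \<zero> \<Longrightarrow> invert y \<in> V"
  unfolding invert_def by (intro scale_closed a_inv_closed inv_closed_nz) (auto simp: integral_iff)

text \<open>The factor \<open>-1/2\<close> in the inversion turns \<open>- 2 x \<bullet> y'\<close>
  into \<open>x \<bullet> y / |y|^2\<close>; taking \<open>1/|y|^2\<close> out of this and of
  \<open>|x|^2\<close> leaves \<open>par_prod x y\<close>. For a fixed \<open>y\<close>, distances
  to the inverted point are thus an affine function of the products.\<close>

lemma nd_invert:
  assumes "x \<in> V" "y \<in> V" "nrm y \<noteq> \<zero>"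
  shows "nd x (invert y) = inv (nrm y) \<otimes> par_prod x y \<oplus> nrm (invert y)"
proof -
  define i where "i = inv (nrm y)"
  define j where "j = inv (two \<otimes> nrm y)"
  have i: "i \<in> carrier F" "i \<otimes> nrm y = \<one>" using assms by (auto simp: i_def)
  have j: "j \<in> carrier F" "j \<otimes> (two \<otimes> nrm y) = \<one>" using assms by (auto simp: j_def integral_iff)
  have "two \<otimes> j = two \<otimes> j \<otimes> (i \<otimes> nrm y)" using i j by simp
  also have "\<dots> = i \<otimes> (j \<otimes> (two \<otimes> nrm y))" using i(1) j(1) nrm_closed[OF assms(2)] two_closed by algebra
  finally have ij: "two \<otimes> j = i" using i j by simp
  have "nd x (invert y) = nrm x \<oplus> nrm (invert y) \<ominus> two \<otimes> (\<ominus> j \<otimes> dot x y)"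
    using assms j invert_closed[of y]
    by (simp add: nd_eq_nrm_dot) (simp add: invert_def dot_scale j_def[symmetric])
  also have "\<dots> = nrm x \<oplus> nrm (invert y) \<oplus> (two \<otimes> j) \<otimes> dot x y"
    using j(1) nrm_closed[OF assms(1)] nrm_closed[OF invert_closed[OF assms(2,3)]]
      dot_closed[OF assms(1,2)] two_closed by algebra
  also have "\<dots> = (i \<otimes> nrm y) \<otimes> nrm x \<oplus> nrm (invert y) \<oplus> i \<otimes> dot x y"
    unfolding ij i(2) using assms by simp
  also have "\<dots> = i \<otimes> par_prod x y \<oplus> nrm (invert y)"
    unfolding par_prod_def
    using i(1) nrm_closed[OF assms(1)] nrm_closed[OF assms(2)] nrm_closed[OF invert_closed[OF assms(2,3)]]
      dot_closed[OF assms(1,2)] by algebra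
  finally show ?thesis unfolding i_def .
qed

text \<open>The scaling factor can be read off from the image: it equals \<open>- 2 |y'|^2\<close>.
  Equal images therefore have equal nonzero factors, which cancel.\<close>

lemma inj_on_invert: "inj_on invert {y \<in> V. nrm y \<noteq> \<zero>}"
proof (rule inj_onI)
  fix y z assume yz: "y \<in> {y \<in> V. nrm y \<noteq> \<zero>}" "z \<in> {y \<in> V. nrm y \<noteq> \<zero>}" "invert y = invert z"
  define c where "c y = \<ominus> (inv (two \<otimes> nrm y))" for y
  have c: "c y \<in> carrier F" "c y \<noteq> \<zero>" "c y = \<ominus> (two \<otimes> nrm (invert y))"
    if "y \<in> {y \<in> V. nrm y \<noteq> \<zero>}" for y
  proof -
    have y: "y \<in> V" "nrm y \<noteq> \<zero>" using that by auto
    have t: "two \<otimes> nrm y \<in> carrier F" "two \<otimes> nrm y \<noteq> \<zero>" using y by (auto simp: integral_iff)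
    show cy: "c y \<in> carrier F" "c y \<noteq> \<zero>"
      unfolding c_def using t uminus_nz[of "inv (two \<otimes> nrm y)"] by auto
    have "c y \<otimes> (two \<otimes> nrm y) = \<ominus> \<one>" unfolding c_def using t by (simp add: l_minus)
    moreover have "\<ominus> (two \<otimes> (c y \<otimes> c y \<otimes> nrm y)) = \<ominus> (c y \<otimes> (c y \<otimes> (two \<otimes> nrm y)))"
      using cy(1) nrm_closed[OF y(1)] two_closed by algebra
    ultimately have "\<ominus> (two \<otimes> (c y \<otimes> c y \<otimes> nrm y)) = c y"
      using cy by (simp add: r_minus minus_minus)
    moreover have "nrm (invert y) = c y \<otimes> c y \<otimes> nrm y"
      unfolding invert_def using cy y by (simp add: nrm_scale c_def)
    ultimately show "c y = \<ominus> (two \<otimes> nrm (invert y))" by simp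
  qed
  have cyz: "c y = c z" using c(3)[OF yz(1)] c(3)[OF yz(2)] yz(3) by simp
  have "y i = z i" if i: "i \<in> {1..n}" for i
  proof -
    have "c y \<otimes> y i = c y \<otimes> z i"
      using fun_cong[OF yz(3), of i] i unfolding invert_def scale_def c_def[symmetric] cyz by simp
    then show ?thesis using c(1,2)[OF yz(1)] yz i by (simp add: m_lcancel)
  qed
  then show "y = z" using yz unfolding ff_vecs_def by (blast intro: PiE_ext)
qed

text \<open>Of the isotropic and the anisotropic points of \<open>A\<close> the larger class is
  kept, at the cost of a factor 2. Isotropic points serve as their own pins, and anisotropic ones
  are replaced by their inversions; either way the distances from a pin are a function of the
  products.\<close>

lemma exists_pins:
  assumes A: "A \<subseteq> V"
  obtains A' B where "A' \<subseteq> V" "B \<subseteq> V" "card A' = card B" "card A \<le> 2 * card B"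
    "\<And>y. y \<in> B \<Longrightarrow> card ((\<lambda>x. nd x y) ` A') \<le> card {par_prod x y | x y. x \<in> A \<and> y \<in> A}"
proof -
  define Z where "Z = {x \<in> A. nrm x = \<zero>}"
  define N where "N = {x \<in> A. nrm x \<noteq> \<zero>}"
  define P where "P = {par_prod x y | x y. x \<in> A \<and> y \<in> A}"
  have fA: "finite A" using A finite_subset finite_V by blast
  have "P = (\<lambda>(x, y). par_prod x y) ` (A \<times> A)" by (auto simp: P_def)
  then have fP: "finite P" using fA by simp
  have "A = Z \<union> N" "Z \<inter> N = {}" by (auto simp: Z_def N_def)
  then have sum: "card A = card Z + card N" using fA by (metis card_Un_disjoint finite_Un)
  have le: "card ((\<lambda>x. nd x y) ` S) \<le> card P" if "\<And>x. x \<in> S \<Longrightarrow> \<exists>p\<in>P. nd x y = g p" for S y g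
  proof -
    have "(\<lambda>x. nd x y) ` S \<subseteq> g ` P" using that by blast
    then show ?thesis using fP card_image_le[OF fP, of g] by (meson card_mono finite_imageI order_trans)
  qed
  show ?thesis
  proof (cases "card N \<le> card Z")
    case True
    have "card ((\<lambda>x. nd x y) ` Z) \<le> card P" if y: "y \<in> Z" for y
    proof (rule le)
      fix x assume x: "x \<in> Z"
      have "nd x y = \<ominus> (two \<otimes> par_prod x y)"
        using x y A by (auto simp: Z_def nd_eq_nrm_dot par_prod_def minus_eq subset_iff)
      moreover have "par_prod x y \<in> P" using x y by (auto simp: P_def Z_def)
      ultimately show "\<exists>p\<in>P. nd x y = \<ominus> (two \<otimes> p)" by blast
    qed
    then show ?thesis using that[of Z Z] A True sum by (auto simp: Z_def P_def)
  next
    case False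
    have NV: "N \<subseteq> {y \<in> V. nrm y \<noteq> \<zero>}" using A by (auto simp: N_def)
    have "card ((\<lambda>x. nd x y) ` N) \<le> card P" if y: "y \<in> invert ` N" for y
    proof -
      obtain z where z: "z \<in> N" "y = invert z" using y by blast
      show ?thesis
      proof (rule le)
        fix x assume x: "x \<in> N"
        have "nd x y = inv (nrm z) \<otimes> par_prod x z \<oplus> nrm y"
          unfolding z(2) using x z NV by (intro nd_invert) auto
        moreover have "par_prod x z \<in> P" using x z by (auto simp: P_def N_def)
        ultimately show "\<exists>p\<in>P. nd x y = inv (nrm z) \<otimes> p \<oplus> nrm y" by blast
      qed
    qed
    moreover have "card (invert ` N) = card N"
      using card_image inj_on_subset[OF inj_on_invert NV] by blast
    moreover have "invert ` N \<subseteq> V" using NV invert_closed by auto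
    ultimately show ?thesis using that[of N "invert ` N"] NV False sum by (auto simp: P_def)
  qed
qed

lemma paraboloid_dot:
  assumes "x \<in> ff_paraboloid F (n + 1)" "y \<in> ff_paraboloid F (n + 1)"
  shows "ff_dot F (n + 1) x y = par_prod (restrict x {1..n}) (restrict y {1..n})"
proof -
  have xy: "x i \<in> carrier F" "y i \<in> carrier F" if "i \<in> {1..n + 1}" for i
    using assms that by (auto simp: ff_paraboloid_def ff_vecs_def)
  have last: "x (n + 1) = nrm (restrict x {1..n})" if "x \<in> ff_paraboloid F (n + 1)" for x
    using that unfolding ff_paraboloid_def nrm_def
    by (auto simp: ff_vecs_def simp_implies_def intro!: finsum_cong)
  have "{1..n + 1} = insert (n + 1) {1..n}" by auto
  then have "ff_dot F (n + 1) x y = x (n + 1) \<otimes> y (n + 1) \<oplus> (\<Oplus>i\<in>{1..n}. x i \<otimes> y i)"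
    unfolding ff_dot_def using xy by (simp add: Pi_iff finsum_insert)
  also have "(\<Oplus>i\<in>{1..n}. x i \<otimes> y i) = dot (restrict x {1..n}) (restrict y {1..n})"
    unfolding ff_dot_def using xy by (intro finsum_cong) (auto simp: simp_implies_def)
  also have "x (n + 1) \<otimes> y (n + 1) \<oplus> dot (restrict x {1..n}) (restrict y {1..n}) =
      par_prod (restrict x {1..n}) (restrict y {1..n})"
    unfolding par_prod_def last[OF assms(1)] last[OF assms(2)] using xy
    by (intro a_comm) (auto simp: ff_vecs_def intro!: m_closed nrm_closed dot_closed)
  finally show ?thesis .
qed

lemma inj_on_restrict_paraboloid:
  "inj_on (\<lambda>x. restrict x {1..n}) (ff_paraboloid F (n + 1))"
proof (rule inj_onI)
  fix x y assume xy: "x \<in> ff_paraboloid F (n + 1)" "y \<in> ff_paraboloid F (n + 1)"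
    and e: "restrict x {1..n} = restrict y {1..n}"
  have eq: "x i = y i" if "i \<in> {1..n}" for i using fun_cong[OF e, of i] that by simp
  have "(\<Oplus>i\<in>{1..n}. x i [^] (2::nat)) = (\<Oplus>i\<in>{1..n}. y i [^] (2::nat))"
    using xy eq by (intro finsum_cong) (auto simp: simp_implies_def ff_paraboloid_def ff_vecs_def)
  then have "x (n + 1) = y (n + 1)" using xy by (simp add: ff_paraboloid_def)
  then have "x i = y i" if "i \<in> {1..n + 1}" for i
    using eq[of i] that by (cases "i = n + 1") auto
  then show "x = y" using xy unfolding ff_paraboloid_def ff_vecs_def by (blast intro: PiE_ext)
qed

section \<open>The exponents and the uniform constants\<close>

theorem paraboloid_products_ge:
  assumes ext: "sphere_extension_estimate F \<chi> (n + 1) C0"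
    and E: "E \<subseteq> ff_paraboloid F (n + 1)"
    and large: "16 * real q powr ((real n ^ 2 + 2 * real n) / (2 * real n + 2)) \<le> card E"
  shows "real q / (4 * (3 + 2 * C0\<^sup>2)) \<le> card (ff_prod_set F (n + 1) E)"
proof -
  define A where "A = (\<lambda>x. restrict x {1..n}) ` E"
  have A: "A \<subseteq> V"
  proof -
    have "restrict x {1..n} \<in> V" if "x \<in> ff_paraboloid F (n + 1)" for x
      using that by (auto simp: ff_paraboloid_def ff_vecs_def)
    then show ?thesis using E by (auto simp: A_def)
  qed
  have cA: "card A = card E"
    unfolding A_def using inj_on_subset[OF inj_on_restrict_paraboloid E] by (rule card_image)
  have prod: "ff_prod_set F (n + 1) E = {par_prod x y | x y. x \<in> A \<and> y \<in> A}"
  proof -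
    have "ff_prod_set F (n + 1) E =
        {par_prod (restrict x {1..n}) (restrict y {1..n}) | x y. x \<in> E \<and> y \<in> E}"
      unfolding ff_prod_set_def
      using paraboloid_dot[OF subsetD[OF E] subsetD[OF E]] by (intro Collect_cong ex_cong1) metis
    then show ?thesis unfolding A_def by blast
  qed
  obtain A' B where B: "A' \<subseteq> V" "B \<subseteq> V" "card A' = card B" "card A \<le> 2 * card B"
    and P: "\<And>y. y \<in> B \<Longrightarrow> card ((\<lambda>x. nd x y) ` A') \<le> card {par_prod x y | x y. x \<in> A \<and> y \<in> A}"
    by (rule exists_pins[OF A], rule that)
  define N where "N = real (card B)"
  define \<alpha> where "\<alpha> = (real n ^ 2 + 2 * real n) / (2 * real n + 2)"
  have n: "real n > 0" using odd_k n_eq by (auto elim!: oddE)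
  have q: "real q \<ge> 1" using q_ge_3 by simp
  \<comment> \<open>The constant 16 is the 8 required by \<open>N1\<close> times the 2 lost in
    \<open>exists_pins\<close>.\<close>
  have N: "8 * real q powr \<alpha> \<le> N"
    using large B(4) cA unfolding N_def \<alpha>_def by linarith
  \<comment> \<open>The exponent is at least half the dimension, which gives
    \<open>N1\<close>.\<close>
  have "real k \<le> \<alpha>"
  proof -
    have nk: "real n = 2 * real k" by (simp add: n_eq)
    show ?thesis using n unfolding \<alpha>_def nk by (simp add: field_simps power2_eq_square)
  qed
  then have "real q ^ k \<le> real q powr \<alpha>"
    using q powr_mono[of "real k" \<alpha> "real q"] by (simp add: powr_realpow)
  then have N1: "8 * real q ^ k \<le> N" using N by linarith
  have qa: "real q powr \<alpha> \<le> N" "0 < real q powr \<alpha>" using N q by (auto intro: order_trans[rotated])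
  then have Npos: "N > 0" by linarith
  \<comment> \<open>The threshold comes from \<open>N2\<close>, which says that \<open>q ^ n\<close>
    is at most \<open>N powr \<beta>\<close>; solving for \<open>N\<close> gives
    \<open>\<alpha> = n / \<beta>\<close>.\<close>
  define \<beta> where "\<beta> = 2 - 2 / (real n + 2)"
  have \<beta>: "\<beta> > 0" "\<alpha> * \<beta> = n"
  proof -
    have b: "\<beta> = (2 * real n + 2) / (real n + 2)" using n by (simp add: \<beta>_def field_simps)
    have a: "\<alpha> = real n * (real n + 2) / (2 * real n + 2)"
      unfolding \<alpha>_def by (simp add: algebra_simps power2_eq_square)
    show "\<beta> > 0" unfolding b using n by (intro divide_pos_pos) auto
    show "\<alpha> * \<beta> = n" unfolding a b using n by simp
  qed
  have "real q ^ n = (real q powr \<alpha>) powr \<beta>"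
    using q by (simp add: powr_powr \<beta> powr_realpow)
  also have "\<dots> \<le> N powr \<beta>" using qa \<beta> by (intro powr_mono2) auto
  finally have "real q ^ n * N powr (2 / (n + 2)) \<le> N powr \<beta> * N powr (2 / (real n + 2))"
    by (intro mult_mono) (auto simp: add.commute)
  also have "\<dots> = N\<^sup>2"
    using Npos by (simp add: powr_add[symmetric] \<beta>_def)
  finally have N2: "real q ^ n * N powr (2 / (n + 2)) \<le> N\<^sup>2" .
  show ?thesis
    using pinned_distances_ge[OF ext B(1,2,3) refl, of "card {par_prod x y | x y. x \<in> A \<and> y \<in> A}"]
      N1 N2 P unfolding prod N_def by blast
qed

end

theorem theorem1p2:
  fixes d :: nat and C\<^sub>0 :: real
  assumes "d mod 4 = 3" and "C\<^sub>0 > 0"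
  shows "\<exists>C>0. \<exists>c>0. \<forall>(F :: 'a ring) \<chi>.
    field F \<longrightarrow> finite (carrier F) \<longrightarrow> card (carrier F) mod 4 = 3 \<longrightarrow>
    nontrivial_additive_character F \<chi> \<longrightarrow>
    sphere_extension_estimate F \<chi> d C\<^sub>0 \<longrightarrow>
    (\<forall>E \<subseteq> ff_paraboloid F d.
       real (card E) \<ge> C * real (card (carrier F)) powr
         (((real d - 1)^2 + 2 * (real d - 1)) / (2 * (real d - 1) + 2)) \<longrightarrow>
       real (card (ff_prod_set F d E)) \<ge> c * real (card (carrier F)))"
proof -
  define n where "n = d - 1"
  have d: "d = n + 1" "real d - 1 = real n" using assms(1) unfolding n_def by (presburger, auto)
  \<comment> \<open>Neither this constant nor the threshold constant 16 depends on the field, as the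
    order of the quantifiers demands.\<close>
  define c where "c = 1 / (4 * (3 + 2 * C\<^sub>0\<^sup>2))"
  have "c > 0" by (auto simp: c_def intro!: add_pos_nonneg)
  have main: "real (card (ff_prod_set F d E)) \<ge> c * real (card (carrier F))"
    if F: "field F" "finite (carrier F)" "card (carrier F) mod 4 = 3"
      "nontrivial_additive_character F \<chi>" and ext: "sphere_extension_estimate F \<chi> d C\<^sub>0"
      and E: "E \<subseteq> ff_paraboloid F d" "real (card E) \<ge> 16 * real (card (carrier F)) powr
         (((real d - 1)^2 + 2 * (real d - 1)) / (2 * (real d - 1) + 2))"
    for F :: "'a ring" and \<chi> E
  proof -
    \<comment> \<open>If \<open>d = 4 m + 3\<close>, then half of \<open>n = 4 m + 2\<close> is the
      odd number \<open>2 m + 1\<close>.\<close>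
    have "n = 2 * (n div 2)" "odd (n div 2)" using assms(1) unfolding n_def by presburger+
    then interpret finite_field_space F \<chi> n "n div 2"
      using F by (intro finite_field_space.intro finite_field_character.intro
        finite_field_character_axioms.intro finite_field_space_axioms.intro)
    show ?thesis
      using paraboloid_products_ge[of C\<^sub>0 E] ext E unfolding d(2) unfolding d(1) c_def by simp
  qed
  show ?thesis
    using main \<open>c > 0\<close> by (intro exI[of _ "16::real"] exI[of _ c] conjI allI impI) auto
qed

end
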